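(* Let $H$ be an abstract group and let $\mathbb{L}$ be a field with $\mathrm{Char}\,\mathbb{L}=0$. Assume that the cardinality of $\mathbb{L}$ is strictly greater than that of $H$. Then for any unipotent algebraic group $U$ defined over $\mathbb{L}$ and for any abstract homomorphism $\phi: U(\mathbb{L})\to H$ the image $\phi(U(\mathbb{L}))$ is abelian.
   Context: Algebraic groups are linear algebraic groups. $U(\mathbb{L})$ is the group of $\mathbb{L}$-rational points of $U$. An abstract homomorphism is a homomorphism of abstract groups. *)

theory Defs
  imports
    "HOL-Library.Poly_Mapping"
    "HOL-Library.Equipollence"
    "HOL-Computational_Algebra.Polynomial"
    "HOL-Algebra.Coset"
    "Jordan_Normal_Form.Matrix"
begin

section \<open>Polynomials in the entries of a matrix\<close>

text \<open>The index pair (i, j) is the variable for the matrix entry at position (i, j); rows and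
  columns are numbered from 0, as in \<^typ>\<open>'a mat\<close>.\<close>

type_synonym 'a matrix_poly = "((nat \<times> nat) \<Rightarrow>\<^sub>0 nat) \<Rightarrow>\<^sub>0 'a"

text \<open>The subring of polynomials in the $n^2$ variables with indices below n.\<close>

definition matrix_polys :: "nat \<Rightarrow> 'a::comm_ring_1 matrix_poly set" where
  "matrix_polys n =
     {p. \<forall>m\<in>Poly_Mapping.keys p. Poly_Mapping.keys m \<subseteq> {..<n} \<times> {..<n}}"

definition eval_at :: "'a::comm_ring_1 mat \<Rightarrow> 'a matrix_poly \<Rightarrow> 'a" where
  "eval_at A p =
     (\<Sum>m\<in>Poly_Mapping.keys p. Poly_Mapping.lookup p m *
        (\<Prod>v\<in>Poly_Mapping.keys m. (A $$ v) ^ Poly_Mapping.lookup m v))"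

text \<open>The ideal of the polynomial ring in $n^2$ variables generated by S.\<close>

definition ideal_generated :: "nat \<Rightarrow> 'a::comm_ring_1 matrix_poly set \<Rightarrow> 'a matrix_poly set" where
  "ideal_generated n S =
     {(\<Sum>q\<in>Q. c q * q) | Q c. finite Q \<and> Q \<subseteq> S \<and> (\<forall>q\<in>Q. c q \<in> matrix_polys n)}"

section \<open>Linear algebraic groups\<close>

definition GL :: "nat \<Rightarrow> 'a::field mat monoid" where
  "GL n = units_of (ring_mat TYPE('a) n ())"

text \<open>Closed sets of \<^term>\<open>GL n\<close> can be cut out by polynomials in the entries alone: a regular
  function on \<^term>\<open>GL n\<close> becomes one after multiplication by a power of the determinant, which
  does not change its zeros.\<close>

definition zariski_closed_in_GL :: "nat \<Rightarrow> 'a::field mat set \<Rightarrow> bool" where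
  "zariski_closed_in_GL n X \<longleftrightarrow>
     (\<exists>P \<subseteq> matrix_polys n. X = {A \<in> carrier (GL n). \<forall>p\<in>P. eval_at A p = 0})"

text \<open>A linear algebraic group is identified with its set of points over an algebraically closed
  field.\<close>

definition linear_algebraic_group :: "nat \<Rightarrow> 'k::alg_closed_field mat set \<Rightarrow> bool" where
  "linear_algebraic_group n U \<longleftrightarrow> subgroup U (GL n) \<and> zariski_closed_in_GL n U"

definition vanishing_ideal :: "nat \<Rightarrow> 'a::field mat set \<Rightarrow> 'a matrix_poly set" where
  "vanishing_ideal n X = {p \<in> matrix_polys n. \<forall>A\<in>X. eval_at A p = 0}"

text \<open>\<^term>\<open>U\<close> is defined over the field \<^typ>\<open>'l\<close>, embedded in \<^typ>\<open>'k\<close> by \<^term>\<open>\<iota>\<close>, if its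
  vanishing ideal is generated by polynomials with coefficients in \<^typ>\<open>'l\<close>. Inverting the
  determinant, which has coefficients in the prime field, gives the same condition on the
  ideal of U in the coordinate ring of \<^term>\<open>GL n\<close>.\<close>

definition defined_over ::
    "('l::field \<Rightarrow> 'k::field) \<Rightarrow> nat \<Rightarrow> 'k mat set \<Rightarrow> bool" where
  "defined_over \<iota> n U \<longleftrightarrow>
     (\<exists>S \<subseteq> matrix_polys n. vanishing_ideal n U = ideal_generated n (Poly_Mapping.map \<iota> ` S))"

definition unipotent_matrix :: "nat \<Rightarrow> 'a::field mat \<Rightarrow> bool" where
  "unipotent_matrix n A \<longleftrightarrow>
     A \<in> carrier_mat n n \<and> (\<exists>k. (A - 1\<^sub>m n) ^\<^sub>m k = 0\<^sub>m n n)"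

definition unipotent_algebraic_group :: "nat \<Rightarrow> 'k::alg_closed_field mat set \<Rightarrow> bool" where
  "unipotent_algebraic_group n U \<longleftrightarrow>
     linear_algebraic_group n U \<and> (\<forall>A\<in>U. unipotent_matrix n A)"

text \<open>The group of \<^typ>\<open>'l\<close>-rational points, realised inside \<^term>\<open>GL n\<close> over \<^typ>\<open>'l\<close> itself.\<close>

definition rational_points ::
    "('l::field \<Rightarrow> 'k::field) \<Rightarrow> nat \<Rightarrow> 'k mat set \<Rightarrow> 'l mat monoid" where
  "rational_points \<iota> n U = (GL n)\<lparr>carrier := {A \<in> carrier (GL n). map_mat \<iota> A \<in> U}\<rparr>"

end

theory Submission
  imports
    Defs
    "HOL-Algebra.Generated_Groups"
    "Jordan_Normal_Form.Schur_Decomposition"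
    "Jordan_Normal_Form.DL_Rank"
begin

text \<open>Write \<open>G\<close> for the group of rational points and \<open>L\<close> for its field. In characteristic 0 every
\<open>x \<in> G\<close> lies on a one-parameter subgroup \<open>t \<mapsto> x\<^sup>t\<close> of \<open>G\<close>, given by the binomial series. If
\<open>L\<close> has more elements than the target \<open>H\<close>, then \<open>t \<mapsto> \<phi> (x\<^sup>t)\<close> is not injective, so some power
\<open>x\<^sup>s\<close> with \<open>s \<noteq> 0\<close> lies in the kernel of \<open>\<phi>\<close>. In a group of class two the commutator is bilinear
over \<open>L\<close>, and one gets \<open>[u, v] = [u\<^sup>s, v\<^sup>1\<^sup>/\<^sup>s]\<close>, which \<open>\<phi>\<close> sends to 1: killing one nonzero multiple
of \<open>u\<close> kills all commutators with \<open>u\<close>.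

For a nilpotent group and \<open>u\<close> in some term of the lower central series, the same identity holds
modulo the term after the next one, so a descending induction along that series shows that all its
terms from the commutator subgroup on lie in the kernel (lemma \<open>image_abelian\<close>).

The identity is clear when the exponent is a natural number. Passing to exponents in \<open>L\<close> modulo a
term \<open>K\<close> of the lower central series is the delicate point, because \<open>K\<close> is taken in the abstract
group \<open>G\<close> and is not known to be Zariski closed. What replaces closedness is the lemma
\<open>interpolation\<close>: if \<open>K\<close> is stable under powers with exponents in \<open>L\<close>, then a polynomial map
\<open>L \<rightarrow> G\<close> that sends the natural numbers into \<open>K\<close> sends all of \<open>L\<close> into \<open>K\<close>. Its proof approximates
the map by a product of powers of its own values, whose exponents are the Lagrange polynomials;
the error moves one step down a central filtration. Stability of the lower central series under
powers is in turn proved by descending induction with the help of the same lemma.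

The filtration comes from Kolchin's theorem (lemma \<open>kolchin\<close>), which provides a flag on
which the group acts unipotently. It is proved for the points over the algebraically closed field
by a trace argument and then restricted to \<open>L\<close>.\<close>

section \<open>Commutators and the lower central series\<close>

definition commutator :: "('a, 'b) monoid_scheme \<Rightarrow> 'a \<Rightarrow> 'a \<Rightarrow> 'a" where
  "commutator G x y = x \<otimes>\<^bsub>G\<^esub> y \<otimes>\<^bsub>G\<^esub> inv\<^bsub>G\<^esub> x \<otimes>\<^bsub>G\<^esub> inv\<^bsub>G\<^esub> y"

context group
begin

lemma inv_mult_cancel: "x \<in> carrier G \<Longrightarrow> y \<in> carrier G \<Longrightarrow> inv x \<otimes> (x \<otimes> y) = y"
  by (simp add: m_assoc[symmetric])

lemma mult_inv_cancel: "x \<in> carrier G \<Longrightarrow> y \<in> carrier G \<Longrightarrow> x \<otimes> (inv x \<otimes> y) = y"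
  by (simp add: m_assoc[symmetric])

lemmas group_cancel = m_assoc inv_mult_cancel mult_inv_cancel inv_mult_group

lemma commutator_closed [simp, intro]:
  "x \<in> carrier G \<Longrightarrow> y \<in> carrier G \<Longrightarrow> commutator G x y \<in> carrier G"
  by (simp add: commutator_def)

lemma mult_commutator_swap:
  assumes "x \<in> carrier G" "y \<in> carrier G"
  shows "commutator G x y \<otimes> (y \<otimes> x) = x \<otimes> y"
  using assms by (simp add: commutator_def group_cancel)

lemma commutator_eq_one_iff:
  assumes "x \<in> carrier G" "y \<in> carrier G"
  shows "commutator G x y = \<one> \<longleftrightarrow> x \<otimes> y = y \<otimes> x"
  using mult_commutator_swap[OF assms] assms by (metis commutator_closed l_one m_closed r_cancel_one)

text \<open>In general \<open>[x, y z] = [x, y] (y [x, z] y\<^sup>-\<^sup>1)\<close>; when \<open>y\<close> commutes with \<open>[x, z]\<close> the conjugation disappears.\<close>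

lemma commutator_mult_right:
  assumes "x \<in> carrier G" "y \<in> carrier G" "z \<in> carrier G"
    and "y \<otimes> commutator G x z = commutator G x z \<otimes> y"
  shows "commutator G x (y \<otimes> z) = commutator G x y \<otimes> commutator G x z"
proof -
  let ?C = "commutator G x z"
  have C: "?C \<in> carrier G" using assms by simp
  have "inv y \<otimes> ?C = ?C \<otimes> inv y"
    using assms C by (metis inv_closed inv_solve_left inv_solve_right m_assoc m_closed)
  then have "commutator G x y \<otimes> ?C = x \<otimes> y \<otimes> inv x \<otimes> (?C \<otimes> inv y)"
    using assms C by (simp add: commutator_def[of G x y] m_assoc)
  also have "\<dots> = commutator G x (y \<otimes> z)"
    using assms by (simp add: commutator_def group_cancel)
  finally show ?thesis by simp
qed

lemma commutator_mult_left:
  assumes "x \<in> carrier G" "y \<in> carrier G" "z \<in> carrier G"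
    and "x \<otimes> commutator G y z = commutator G y z \<otimes> x"
  shows "commutator G (x \<otimes> y) z = commutator G y z \<otimes> commutator G x z"
proof -
  let ?C = "commutator G y z"
  have C: "?C \<in> carrier G" using assms by simp
  have "?C \<otimes> commutator G x z = (?C \<otimes> x) \<otimes> (z \<otimes> inv x \<otimes> inv z)"
    using assms by (simp add: commutator_def[of G x z] m_assoc C)
  also have "\<dots> = x \<otimes> ?C \<otimes> (z \<otimes> inv x \<otimes> inv z)" using assms(4) by simp
  also have "\<dots> = commutator G (x \<otimes> y) z"
    using assms(1-3) by (simp add: commutator_def group_cancel)
  finally show ?thesis by simp
qed

text \<open>The sequence \<open>w\<close> is the sequence of powers of \<open>v\<close>, given by its recursion so that it can be
instantiated directly with the images of powers with exponents in a field.\<close>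

lemma commutator_pow_right:
  assumes "u \<in> carrier G" "v \<in> carrier G" and w: "\<And>m. w m \<in> carrier G"
    and "w 0 = \<one>" "\<And>m::nat. w (Suc m) = w m \<otimes> v"
    and central: "\<And>y. y \<in> carrier G \<Longrightarrow> y \<otimes> commutator G u v = commutator G u v \<otimes> y"
  shows "commutator G u (w m) = commutator G u v [^] m"
proof (induction m)
  case 0
  show ?case using assms by (simp add: commutator_eq_one_iff)
next
  case (Suc m)
  have "commutator G u (w m \<otimes> v) = commutator G u (w m) \<otimes> commutator G u v"
    using assms by (intro commutator_mult_right) auto
  then show ?case using Suc assms by simp
qed

lemma commutator_pow_left:
  assumes "u \<in> carrier G" "v \<in> carrier G" and w: "\<And>m. w m \<in> carrier G"
    and "w 0 = \<one>" "\<And>m::nat. w (Suc m) = w m \<otimes> u"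
    and central: "\<And>y. y \<in> carrier G \<Longrightarrow> y \<otimes> commutator G u v = commutator G u v \<otimes> y"
  shows "commutator G (w m) v = commutator G u v [^] m"
proof (induction m)
  case 0
  show ?case using assms by (simp add: commutator_eq_one_iff)
next
  case (Suc m)
  have "commutator G (w m \<otimes> u) v = commutator G u v \<otimes> commutator G (w m) v"
    using assms by (intro commutator_mult_left) auto
  also have "\<dots> = commutator G u v [^] m \<otimes> commutator G u v"
    using Suc assms by (simp add: central)
  finally show ?case using assms by simp
qed

end

lemma (in group_hom) hom_commutator:
  "x \<in> carrier G \<Longrightarrow> y \<in> carrier G \<Longrightarrow>
    h (commutator G x y) = commutator H (h x) (h y)"
  by (simp add: commutator_def)

fun lower_central :: "('a, 'b) monoid_scheme \<Rightarrow> nat \<Rightarrow> 'a set" where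
  "lower_central G 0 = carrier G"
| "lower_central G (Suc i) =
     generate G {commutator G x y | x y. x \<in> lower_central G i \<and> y \<in> carrier G}"

declare lower_central.simps(2) [simp del]

context group
begin

text \<open>A conjugate of \<open>[x, y]\<close> is the commutator of the conjugates, so the generators of each term are
permuted by conjugation once the previous term is normal.\<close>

lemma lower_central_normal: "lower_central G i \<lhd> G"
proof (induction i)
  case 0
  show ?case by (simp add: normal_inv_iff subgroup_self)
next
  case (Suc i)
  interpret N: normal "lower_central G i" G by (fact Suc)
  show ?case unfolding lower_central.simps
  proof (rule normal_generateI)
    show "{commutator G x y |x y. x \<in> lower_central G i \<and> y \<in> carrier G} \<subseteq> carrier G"
      using N.subset by auto
  next
    fix h g
    assume "h \<in> {commutator G x y |x y. x \<in> lower_central G i \<and> y \<in> carrier G}" and g: "g \<in> carrier G"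
    then obtain x y where x: "x \<in> lower_central G i" and y: "y \<in> carrier G"
      and h: "h = commutator G x y" by auto
    have xc: "x \<in> carrier G" using x N.subset by auto
    have "g \<otimes> h \<otimes> inv g = commutator G (g \<otimes> x \<otimes> inv g) (g \<otimes> y \<otimes> inv g)"
      using xc y g by (simp add: h commutator_def group_cancel)
    moreover have "g \<otimes> x \<otimes> inv g \<in> lower_central G i" using N.inv_op_closed2 x g by simp
    ultimately show "g \<otimes> h \<otimes> inv g
        \<in> {commutator G x y |x y. x \<in> lower_central G i \<and> y \<in> carrier G}"
      using y g by auto
  qed
qed

lemma lower_central_subgroup: "subgroup (lower_central G i) G"
  using lower_central_normal normal_imp_subgroup by blast

lemma lower_central_carrier: "x \<in> lower_central G i \<Longrightarrow> x \<in> carrier G"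
  using lower_central_subgroup subgroup.subset by blast

lemma commutator_in_lower_central:
  "x \<in> lower_central G i \<Longrightarrow> y \<in> carrier G \<Longrightarrow> commutator G x y \<in> lower_central G (Suc i)"
  by (auto simp: lower_central.simps(2) intro: generate.incl)

lemma lower_central_decreasing: "lower_central G (Suc i) \<subseteq> lower_central G i"
proof -
  interpret N: normal "lower_central G i" G by (fact lower_central_normal)
  have "commutator G x y \<in> lower_central G i" if "x \<in> lower_central G i" "y \<in> carrier G" for x y
  proof -
    have xc: "x \<in> carrier G" using that N.subset by auto
    have "commutator G x y = x \<otimes> (y \<otimes> inv x \<otimes> inv y)"
      using xc that by (simp add: commutator_def m_assoc)
    then show ?thesis using that N.inv_op_closed2 by auto
  qed
  then show ?thesis unfolding lower_central.simps
    by (intro generate_subgroup_incl) (auto intro: N.subgroup_axioms)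
qed

end

section \<open>Groups with powers in a field\<close>

text \<open>The set \<open>P\<close> consists of the polynomial maps from the field to the group. The last assumption is the
substitute for Zariski density of the natural numbers. It is required for all subgroups that are
closed under powers, since it will be applied to terms of the lower central series, which are known
to be power-closed but not to be closed in any topology.\<close>

locale powered_group = group G for G (structure) +
  fixes pw :: "'a \<Rightarrow> 'l::field_char_0 \<Rightarrow> 'a" and P :: "('l \<Rightarrow> 'a) set"
  assumes P_closed: "f \<in> P \<Longrightarrow> f t \<in> carrier G"
    and P_const: "x \<in> carrier G \<Longrightarrow> (\<lambda>t. x) \<in> P"
    and P_mult: "f \<in> P \<Longrightarrow> g \<in> P \<Longrightarrow> (\<lambda>t. f t \<otimes> g t) \<in> P"
    and P_inv: "f \<in> P \<Longrightarrow> (\<lambda>t. inv (f t)) \<in> P"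
    and P_pw: "x \<in> carrier G \<Longrightarrow> pw x \<in> P"
    and pw_add: "x \<in> carrier G \<Longrightarrow> pw x (s + t) = pw x s \<otimes> pw x t"
    and pw_one: "x \<in> carrier G \<Longrightarrow> pw x 1 = x"
    and pw_pw: "x \<in> carrier G \<Longrightarrow> pw (pw x s) t = pw x (s * t)"
    and interpolation: "subgroup K G \<Longrightarrow> (\<And>x t. x \<in> K \<Longrightarrow> pw x t \<in> K) \<Longrightarrow>
          f \<in> P \<Longrightarrow> (\<And>m. f (of_nat m) \<in> K) \<Longrightarrow> f t \<in> K"
begin

lemma pw_closed [simp, intro]: "x \<in> carrier G \<Longrightarrow> pw x t \<in> carrier G"
  using P_closed[OF P_pw] .

lemma pw_zero: "x \<in> carrier G \<Longrightarrow> pw x 0 = \<one>"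
  using pw_add[of x 0 0] by (metis add.right_neutral l_cancel_one pw_closed)

lemma pw_of_nat: "x \<in> carrier G \<Longrightarrow> pw x (of_nat m) = x [^] m"
proof (induction m)
  case (Suc m)
  have "pw x (of_nat (Suc m)) = pw x (of_nat m + 1)" by (simp add: add.commute)
  then show ?case using Suc by (simp add: pw_add pw_one del: of_nat_Suc)
qed (simp add: pw_zero)

lemma pw_Suc: "x \<in> carrier G \<Longrightarrow> pw x (of_nat (Suc m)) = pw x (of_nat m) \<otimes> x"
  by (simp add: pw_of_nat del: of_nat_Suc)

lemma pw_inv: "x \<in> carrier G \<Longrightarrow> pw (inv x) t = pw x (- t)"
proof -
  assume x: "x \<in> carrier G"
  have "pw x (-1) \<otimes> x = \<one>" using pw_add[OF x, of "-1" 1] x by (simp add: pw_one pw_zero)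
  then have "inv x = pw x (-1)" using x by (simp add: inv_equality)
  then show ?thesis using x by (simp add: pw_pw)
qed

lemma P_commutator: "f \<in> P \<Longrightarrow> g \<in> P \<Longrightarrow> (\<lambda>t. commutator G (f t) (g t)) \<in> P"
  unfolding commutator_def by (intro P_mult P_inv)

definition power_closed :: "'a set \<Rightarrow> bool" where
  "power_closed K \<longleftrightarrow> (\<forall>x\<in>K. \<forall>t. pw x t \<in> K)"

lemma coset_eq_iff:
  assumes "K \<lhd> G" "x \<in> carrier G" "y \<in> carrier G"
  shows "K #> x = K #> y \<longleftrightarrow> x \<otimes> inv y \<in> K"
proof -
  interpret K: normal K G by fact
  show ?thesis
    using K.rcos_module[OF is_group assms(3,2)] assms K.subgroup_axioms
    by (metis K.is_subgroup repr_independence rcos_self)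
qed

context
  fixes K assumes K: "K \<lhd> G" "power_closed K"
begin

lemma P_determined_by_naturals:
  assumes fg: "f \<in> P" "g \<in> P" and eq: "\<And>m. K #> f (of_nat m) = K #> g (of_nat m)"
  shows "K #> f t = K #> g t"
proof -
  have "f t \<otimes> inv (g t) \<in> K"
  proof (rule interpolation[of K "\<lambda>t. f t \<otimes> inv (g t)"])
    show "subgroup K G" using K(1) by (rule normal_imp_subgroup)
    show "(\<lambda>t. f t \<otimes> inv g t) \<in> P" using fg by (intro P_mult P_inv)
    show "f (of_nat m) \<otimes> inv g (of_nat m) \<in> K" for m
      using eq[of m] coset_eq_iff[OF K(1)] fg P_closed by blast
  qed (use K(2) in \<open>auto simp: power_closed_def\<close>)
  then show ?thesis using coset_eq_iff[OF K(1)] fg P_closed by blast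
qed

lemma quotient_hom: "group_hom G (G Mod K) (r_coset G K)"
proof -
  interpret K: normal K G by (fact K)
  show ?thesis
    by (intro group_hom.intro group_hom_axioms.intro K.factorgroup_is_group is_group K.r_coset_hom_Mod)
qed

lemma commute_mod:
  assumes "x \<in> carrier G" "y \<in> carrier G" "commutator G x y \<in> K"
  shows "(K #> x) \<otimes>\<^bsub>G Mod K\<^esub> (K #> y) = (K #> y) \<otimes>\<^bsub>G Mod K\<^esub> (K #> x)"
proof -
  interpret \<pi>: group_hom G "G Mod K" "r_coset G K" by (fact quotient_hom)
  have "x \<otimes> y \<otimes> inv (y \<otimes> x) = commutator G x y"
    using assms by (simp add: commutator_def group_cancel)
  then have "K #> (x \<otimes> y) = K #> (y \<otimes> x)"
    unfolding coset_eq_iff[OF K(1) m_closed[OF assms(1,2)] m_closed[OF assms(2,1)]]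
    using assms(3) by simp
  then show ?thesis
    unfolding \<pi>.hom_mult[OF assms(1,2), symmetric] \<pi>.hom_mult[OF assms(2,1), symmetric] .
qed

text \<open>Both sides are polynomial in \<open>t\<close>, and for natural \<open>t\<close> this is the power law for the commuting cosets
of \<open>a\<close> and \<open>b\<close>.\<close>

lemma pw_mult_mod:
  assumes a: "a \<in> carrier G" and b: "b \<in> carrier G" and ab: "commutator G a b \<in> K"
  shows "K #> pw (a \<otimes> b) t = K #> pw a t \<otimes> pw b t"
proof (rule P_determined_by_naturals)
  interpret \<pi>: group_hom G "G Mod K" "r_coset G K" by (fact quotient_hom)
  show "pw (a \<otimes> b) \<in> P" "(\<lambda>t. pw a t \<otimes> pw b t) \<in> P"
    using a b by (auto intro: P_pw P_mult)
  show "K #> pw (a \<otimes> b) (of_nat m) = K #> pw a (of_nat m) \<otimes> pw b (of_nat m)" for m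
    using a b \<pi>.H.pow_mult_distrib[OF commute_mod[OF a b ab]]
    by (simp add: pw_of_nat \<pi>.hom_nat_pow)
qed

text \<open>The commutator is bilinear over the field modulo \<open>K\<close> as soon as \<open>[u, v]\<close> is central modulo \<open>K\<close>. For
natural exponents it follows from additivity in each variable, and the rest is interpolation.\<close>

lemma pw_commutator_mod:
  assumes u: "u \<in> carrier G" and v: "v \<in> carrier G"
    and central: "\<And>y. y \<in> carrier G \<Longrightarrow> commutator G (commutator G u v) y \<in> K"
  shows "K #> commutator G u (pw v t) = K #> pw (commutator G u v) t"
    and "K #> commutator G (pw u t) v = K #> pw (commutator G u v) t"
proof -
  interpret \<pi>: group_hom G "G Mod K" "r_coset G K" by (fact quotient_hom)
  let ?c = "commutator (G Mod K) (K #> u) (K #> v)"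
  have c: "?c = K #> commutator G u v" using u v by (simp add: \<pi>.hom_commutator)
  have central': "y \<otimes>\<^bsub>G Mod K\<^esub> ?c = ?c \<otimes>\<^bsub>G Mod K\<^esub> y" if y: "y \<in> carrier (G Mod K)" for y
  proof -
    obtain z where z: "z \<in> carrier G" "y = K #> z"
      using y unfolding carrier_FactGroup by blast
    show ?thesis
      unfolding c z(2) by (rule commute_mod[OF commutator_closed[OF u v] z(1) central[OF z(1)], symmetric])
  qed
  have pw_Suc_mod: "K #> pw x (of_nat (Suc m)) = (K #> pw x (of_nat m)) \<otimes>\<^bsub>G Mod K\<^esub> (K #> x)"
    if "x \<in> carrier G" for x m
    using that by (simp add: pw_Suc del: of_nat_Suc)
  have pw_zero_mod: "K #> pw x (of_nat 0) = \<one>\<^bsub>G Mod K\<^esub>" if "x \<in> carrier G" for x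
    using that \<pi>.hom_one by (simp add: pw_zero)
  show "K #> commutator G u (pw v t) = K #> pw (commutator G u v) t"
  proof (rule P_determined_by_naturals)
    show "(\<lambda>t. commutator G u (pw v t)) \<in> P" "pw (commutator G u v) \<in> P"
      using u v by (auto intro: P_commutator P_const P_pw)
    fix m
    have "commutator (G Mod K) (K #> u) (K #> pw v (of_nat m)) = ?c [^]\<^bsub>G Mod K\<^esub> m"
      using u v central' pw_Suc_mod[OF v] pw_zero_mod[OF v]
      by (intro \<pi>.H.commutator_pow_right) auto
    then show "K #> commutator G u (pw v (of_nat m)) = K #> pw (commutator G u v) (of_nat m)"
      by (simp only: \<pi>.hom_commutator[OF u pw_closed[OF v]] c
          pw_of_nat[OF commutator_closed[OF u v]] \<pi>.hom_nat_pow[OF commutator_closed[OF u v]])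
  qed
  show "K #> commutator G (pw u t) v = K #> pw (commutator G u v) t"
  proof (rule P_determined_by_naturals)
    show "(\<lambda>t. commutator G (pw u t) v) \<in> P" "pw (commutator G u v) \<in> P"
      using u v by (auto intro: P_commutator P_const P_pw)
    fix m
    have "commutator (G Mod K) (K #> pw u (of_nat m)) (K #> v) = ?c [^]\<^bsub>G Mod K\<^esub> m"
      using u v central' pw_Suc_mod[OF u] pw_zero_mod[OF u]
      by (intro \<pi>.H.commutator_pow_left) auto
    then show "K #> commutator G (pw u (of_nat m)) v = K #> pw (commutator G u v) (of_nat m)"
      by (simp only: \<pi>.hom_commutator[OF pw_closed[OF u] v] c
          pw_of_nat[OF commutator_closed[OF u v]] \<pi>.hom_nat_pow[OF commutator_closed[OF u v]])
  qed
qed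

end

lemma mem_lower_central_of_coset_eq:
  assumes "lower_central G (Suc i) #> x = lower_central G (Suc i) #> y"
    and x: "x \<in> carrier G" and y: "y \<in> lower_central G i"
  shows "x \<in> lower_central G i"
proof -
  interpret C: subgroup "lower_central G i" G by (fact lower_central_subgroup)
  have yc: "y \<in> carrier G" using y by (rule lower_central_carrier)
  have "x \<otimes> inv y \<in> lower_central G i"
    using assms(1) coset_eq_iff[OF lower_central_normal x yc] lower_central_decreasing by blast
  then have "x \<otimes> inv y \<otimes> y \<in> lower_central G i" using y by (rule C.m_closed)
  then show ?thesis using x yc by (simp add: m_assoc)
qed

text \<open>A power of a generator satisfies \<open>[u, v]\<^sup>t = [u, v\<^sup>t]\<close> modulo the next term, and the right-hand side is
again a generator. Powers of products are products of powers modulo the next term because the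
quotient of consecutive terms is abelian.\<close>

lemma lower_central_power_closed_step:
  assumes pc: "power_closed (lower_central G (Suc i))"
  shows "power_closed (lower_central G i)"
proof (cases i)
  case 0
  then show ?thesis by (simp add: power_closed_def)
next
  case (Suc j)
  let ?C = "lower_central G i"
  interpret C: subgroup ?C G by (fact lower_central_subgroup)
  have gen: "pw (commutator G u v) t \<in> ?C" if u: "u \<in> lower_central G j" and v: "v \<in> carrier G" for u v t
  proof (rule mem_lower_central_of_coset_eq)
    show "lower_central G (Suc i) #> pw (commutator G u v) t
        = lower_central G (Suc i) #> commutator G u (pw v t)"
      using commutator_in_lower_central[OF commutator_in_lower_central[OF u v]] Suc
      by (intro pw_commutator_mod(1)[OF lower_central_normal pc lower_central_carrier[OF u] v,
            symmetric]) simp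
    show "commutator G u (pw v t) \<in> ?C"
      unfolding Suc using u v by (intro commutator_in_lower_central) auto
    show "pw (commutator G u v) t \<in> carrier G" using v lower_central_carrier[OF u] by auto
  qed
  have "x \<in> ?C \<Longrightarrow> \<forall>t. pw x t \<in> ?C" for x
    unfolding Suc lower_central.simps
  proof (induction x rule: generate.induct)
    case one
    \<comment> \<open>Here 1 is regarded as its own power with exponent 0.\<close>
    have "pw \<one> t = \<one>" for t using pw_pw[of \<one> 0 t] by (simp add: pw_zero)
    then show ?case by (simp add: generate.one)
  next
    case (incl h)
    then show ?case using gen unfolding Suc lower_central.simps by auto
  next
    case (inv h)
    then obtain u v where h: "h = commutator G u v" "u \<in> lower_central G j" "v \<in> carrier G" by auto
    then have "h \<in> carrier G" using lower_central_carrier by blast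
    then show ?case using gen[OF h(2,3)] h(1) unfolding Suc lower_central.simps by (simp add: pw_inv)
  next
    case (eng a b)
    have a: "a \<in> ?C" and b: "b \<in> ?C" using eng unfolding Suc lower_central.simps by auto
    have "pw (a \<otimes> b) t \<in> ?C" for t
    proof (rule mem_lower_central_of_coset_eq[OF pw_mult_mod[OF lower_central_normal pc]])
      show "a \<in> carrier G" "b \<in> carrier G" "pw (a \<otimes> b) t \<in> carrier G"
        using a b by auto
      show "commutator G a b \<in> lower_central G (Suc i)"
        using a b by (intro commutator_in_lower_central) auto
      show "pw a t \<otimes> pw b t \<in> ?C"
        using eng unfolding Suc lower_central.simps by (auto intro: generate.eng)
    qed
    then show ?case unfolding Suc lower_central.simps by simp
  qed
  then show ?thesis by (simp add: power_closed_def)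
qed

lemma lower_central_power_closed:
  assumes "lower_central G N = {\<one>}"
  shows "power_closed (lower_central G i)"
proof -
  have "power_closed (lower_central G N)"
    using assms pw_pw[of \<one> 0] by (simp add: power_closed_def pw_zero)
  then have "power_closed (lower_central G (N - k))" for k
  proof (induction k)
    case (Suc k)
    show ?case
    proof (cases "k < N")
      case True
      then have "N - k = Suc (N - Suc k)" by simp
      then show ?thesis using Suc lower_central_power_closed_step by metis
    qed (use Suc in simp)
  qed simp
  moreover have "lower_central G (N + k) = {\<one>}" for k
  proof (induction k)
    case (Suc k)
    then have "lower_central G (N + Suc k) \<subseteq> {\<one>}"
      using lower_central_decreasing[of "N + k"] by simp
    then show ?case using subgroup.one_closed[OF lower_central_subgroup[of "N + Suc k"]] by blast
  qed (use assms in simp)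
  ultimately show ?thesis
    using \<open>power_closed (lower_central G N)\<close> assms
    by (metis diff_diff_cancel le_add_diff_inverse nat_le_linear)
qed

text \<open>Once a commutator \<open>[u, v]\<close> is bilinear modulo a term that \<open>\<phi>\<close> kills, it can be moved to a power of \<open>u\<close>
in the kernel, at the cost of replacing \<open>v\<close> by its power with the inverse exponent.\<close>

theorem image_abelian:
  assumes H: "group H" and \<phi>: "\<phi> \<in> hom G H" and nilpotent: "lower_central G N = {\<one>}"
    and collapse: "\<And>u. u \<in> carrier G \<Longrightarrow> \<exists>s. s \<noteq> 0 \<and> \<phi> (pw u s) = \<one>\<^bsub>H\<^esub>"
    and xy: "x \<in> carrier G" "y \<in> carrier G"
  shows "\<phi> x \<otimes>\<^bsub>H\<^esub> \<phi> y = \<phi> y \<otimes>\<^bsub>H\<^esub> \<phi> x"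
proof -
  interpret \<phi>: group_hom G H \<phi> by (intro group_hom.intro group_hom_axioms.intro is_group H \<phi>)
  have step: "lower_central G (Suc i) \<subseteq> kernel G H \<phi>"
    if IH: "lower_central G (Suc (Suc i)) \<subseteq> kernel G H \<phi>" for i
  proof -
    have "commutator G u v \<in> kernel G H \<phi>" if u: "u \<in> lower_central G i" and v: "v \<in> carrier G" for u v
    proof -
      let ?K = "lower_central G (Suc (Suc i))"
      have pc: "power_closed ?K" using nilpotent by (rule lower_central_power_closed)
      have uc: "u \<in> carrier G" using u by (rule lower_central_carrier)
      obtain s where s: "s \<noteq> 0" "\<phi> (pw u s) = \<one>\<^bsub>H\<^esub>" using collapse[OF uc] by auto
      \<comment> \<open>Then \<open>[u, v] = [u, w\<^sup>s] = [u, w]\<^sup>s = [u\<^sup>s, w]\<close> modulo \<open>?K\<close>.\<close>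
      define w where "w = pw v (1 / s)"
      have w: "w \<in> carrier G" and ws: "pw w s = v"
        using v s by (auto simp: w_def pw_pw pw_one)
      have "?K #> commutator G u v = ?K #> commutator G (pw u s) w"
        using pw_commutator_mod[OF lower_central_normal pc uc w
            commutator_in_lower_central[OF commutator_in_lower_central[OF u w]], of s] ws by simp
      then have "commutator G u v \<otimes> inv (commutator G (pw u s) w) \<in> ?K"
        using coset_eq_iff[OF lower_central_normal] uc v w by (metis commutator_closed pw_closed)
      then have "\<phi> (commutator G u v \<otimes> inv (commutator G (pw u s) w)) = \<one>\<^bsub>H\<^esub>"
        using IH by (auto simp: kernel_def)
      moreover have "\<phi> (commutator G (pw u s) w) = \<one>\<^bsub>H\<^esub>"
        using uc w s(2) \<phi>.H.commutator_eq_one_iff[of "\<one>\<^bsub>H\<^esub>" "\<phi> w"]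
        by (simp add: \<phi>.hom_commutator)
      ultimately show ?thesis using uc v w by (simp add: kernel_def)
    qed
    then show ?thesis unfolding lower_central.simps
      by (intro generate_subgroup_incl \<phi>.subgroup_kernel) auto
  qed
  have "lower_central G (Suc (N - k)) \<subseteq> kernel G H \<phi>" for k
  proof (induction k)
    case 0
    show ?case using lower_central_decreasing[of N] nilpotent by (auto simp: kernel_def)
  next
    case (Suc k)
    show ?case
    proof (cases "k < N")
      case True
      then have "N - k = Suc (N - Suc k)" by simp
      then show ?thesis using Suc step by metis
    qed (use Suc in simp)
  qed
  from this[of N] have "commutator G x y \<in> kernel G H \<phi>"
    using commutator_in_lower_central[of x 0 y] xy by auto
  then show ?thesis using xy
    by (simp add: kernel_def \<phi>.hom_commutator \<phi>.H.commutator_eq_one_iff)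
qed

end

section \<open>Kolchin's theorem\<close>

definition trace :: "'a::comm_ring_1 mat \<Rightarrow> 'a" where
  "trace A = (\<Sum>i<dim_row A. A $$ (i, i))"

lemma trace_mult_commute:
  assumes "A \<in> carrier_mat n n" "B \<in> carrier_mat n n"
  shows "trace (A * B) = trace (B * A)"
proof -
  have "trace (A * B) = (\<Sum>i<n. \<Sum>j<n. A $$ (i, j) * B $$ (j, i))"
    using assms by (simp add: trace_def scalar_prod_def atLeast0LessThan)
  also have "\<dots> = (\<Sum>j<n. \<Sum>i<n. B $$ (j, i) * A $$ (i, j))"
    by (subst sum.swap) (simp add: mult.commute)
  also have "\<dots> = trace (B * A)"
    using assms by (simp add: trace_def scalar_prod_def atLeast0LessThan)
  finally show ?thesis .
qed

lemma trace_add: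
  "A \<in> carrier_mat n n \<Longrightarrow> B \<in> carrier_mat n n \<Longrightarrow> trace (A + B) = trace A + trace B"
  by (simp add: trace_def sum.distrib)

lemma trace_smult: "A \<in> carrier_mat n n \<Longrightarrow> trace (c \<cdot>\<^sub>m A) = c * trace A"
  by (simp add: trace_def sum_distrib_left)

lemma trace_similar:
  assumes "similar_mat A B" "A \<in> carrier_mat n n"
  shows "trace A = trace B"
proof -
  obtain P Q where w: "similar_mat_wit A B P Q" using assms by (auto simp: similar_mat_def)
  note w = similar_mat_witD2[OF assms(2) w]
  have "trace A = trace (P * (B * Q))" using w by simp
  also have "\<dots> = trace (B * Q * P)" using w by (intro trace_mult_commute) auto
  also have "B * Q * P = B" using w by (simp add: assoc_mult_mat[of B n n Q n P n])
  finally show ?thesis .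
qed

text \<open>Complete an eigenvector to a basis. In this basis the first column is a multiple of the first unit
vector, and induction applies to the lower right block.\<close>

lemma similar_to_upper_triangular:
  fixes A :: "'k::alg_closed_field mat"
  assumes "A \<in> carrier_mat n n"
  shows "\<exists>B\<in>carrier_mat n n. upper_triangular B \<and> similar_mat A B"
  using assms
proof (induction n arbitrary: A)
  case 0
  then show ?case by (intro bexI[of _ A] conjI similar_mat_refl) auto
next
  case (Suc n A)
  let ?N = "Suc n"
  have A: "A \<in> carrier_mat ?N ?N" by fact
  have "degree (char_poly A) > 0" using degree_monic_char_poly[OF A] by simp
  then obtain e where "poly (char_poly A) e = 0" using alg_closed_imp_poly_has_root by blast
  then have "eigenvalue A e" using eigenvalue_root_char_poly[OF A] by simp
  then obtain v where v: "v \<in> carrier_vec ?N" "v \<noteq> 0\<^sub>v ?N" "A *\<^sub>v v = e \<cdot>\<^sub>v v"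
    using A by (auto simp: eigenvalue_def eigenvector_def)
  interpret vec_space "TYPE('k)" ?N .
  define b where "b = basis_completion v"
  define W where "W = mat_of_cols ?N b"
  note b = basis_completion[OF v(1,2), folded b_def]
  have W: "W \<in> carrier_mat ?N ?N" using b(6) by (simp add: W_def mat_of_cols_def)
  have cols_W: "cols W = b" unfolding W_def using b(2) by (rule cols_mat_of_cols)
  have "rank W = ?N" using lin_indpt_full_rank[OF W] b(4,5) cols_W by simp
  then have "det W \<noteq> 0" using det_rank_iff[OF W] by simp
  then obtain W' where W': "W' \<in> carrier_mat ?N ?N" and inv: "W' * W = 1\<^sub>m ?N" "W * W' = 1\<^sub>m ?N"
    using det_non_zero_imp_unit[OF W, of "()"] by (auto simp: Units_def ring_mat_def)
  define A' where "A' = W' * A * W"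
  have A': "A' \<in> carrier_mat ?N ?N" using A W W' by (simp add: A'_def)
  have sim: "similar_mat A A'"
  proof (rule similar_matI)
    show "{A, A', W, W'} \<subseteq> carrier_mat ?N ?N" using A A' W W' by simp
    have "W * A' * W' = W * (W' * (A * W)) * W'"
      using A W W' by (simp add: A'_def assoc_mult_mat[of W' ?N ?N A ?N W ?N])
    also have "\<dots> = (W * W') * (A * W) * W'"
      using A W W' by (simp add: assoc_mult_mat[of W ?N ?N W' ?N "A * W" ?N])
    also have "\<dots> = A * (W * W')"
      using A W W' inv by (simp add: assoc_mult_mat[of A ?N ?N W ?N W' ?N])
    finally show "A = W * A' * W'" using A inv by simp
  qed (use inv in auto)
  have col_W: "col W 0 = v"
    using b(6,7) cols_W W by (metis carrier_matD(2) cols_length cols_nth hd_conv_nth length_0_conv zero_less_Suc nat.distinct(1))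
  have v_unit: "W' *\<^sub>v v = unit_vec ?N 0"
  proof -
    have "W' *\<^sub>v v = col (W' * W) 0" using col_W W W' by (simp add: col_mult2[of W' ?N ?N W ?N 0])
    then show ?thesis using inv by simp
  qed
  have "col A' 0 = W' * A *\<^sub>v v"
    unfolding A'_def using W A W' col_W by (subst col_mult2[of "W' * A" ?N ?N W ?N 0]) auto
  also have "\<dots> = W' *\<^sub>v (A *\<^sub>v v)"
    using W' A v(1) by (rule assoc_mult_mat_vec)
  also have "\<dots> = e \<cdot>\<^sub>v unit_vec ?N 0"
    using v W' v_unit by (simp add: mult_mat_vec[of W' ?N ?N v e])
  finally have col_A': "col A' 0 = e \<cdot>\<^sub>v unit_vec ?N 0" .
  obtain A1 A2 A0 A3 where split: "split_block A' 1 1 = (A1, A2, A0, A3)"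
    by (cases "split_block A' 1 1") auto
  have dims: "dim_row A' = 1 + n" "dim_col A' = 1 + n" using A' by auto
  note blocks = split_block[OF split dims]
  have A0: "A0 = 0\<^sub>m n 1"
  proof (rule eq_matI)
    fix i j assume ij: "i < dim_row (0\<^sub>m n 1)" "j < dim_col (0\<^sub>m n 1)"
    then have "A0 $$ (i, j) = A' $$ (Suc i, 0)"
      using split A' by (auto simp: split_block_def Let_def)
    also have "\<dots> = col A' 0 $ Suc i" using ij A' by simp
    also have "\<dots> = 0" using ij by (simp add: col_A')
    finally show "A0 $$ (i, j) = 0\<^sub>m n 1 $$ (i, j)" using ij by simp
  qed (use blocks in auto)
  obtain B3 where B3: "B3 \<in> carrier_mat n n" "upper_triangular B3" "similar_mat A3 B3"
    using Suc.IH[of A3] blocks by auto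
  obtain B0 where B0: "B0 \<in> carrier_mat 1 n"
    and sim': "similar_mat (four_block_mat A1 A2 (0\<^sub>m n 1) A3) (four_block_mat A1 B0 (0\<^sub>m n 1) B3)"
    using similar_mat_four_block_0_ex[OF similar_mat_refl[of A1 1] B3(3), of A2] blocks by auto
  have "similar_mat A (four_block_mat A1 B0 (0\<^sub>m n 1) B3)"
    using similar_mat_trans[OF sim] sim' blocks(5) A0 by simp
  moreover have "upper_triangular (four_block_mat A1 B0 (0\<^sub>m n 1) B3)"
    using blocks(1) B3 by (intro upper_triangular_four_block) auto
  moreover have "four_block_mat A1 B0 (0\<^sub>m n 1) B3 \<in> carrier_mat ?N ?N"
    using four_block_carrier_mat[OF blocks(1) B3(1)] by simp
  ultimately show ?case by blast
qed

lemma upper_triangular_mult: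
  fixes A B :: "'a::comm_ring_1 mat"
  assumes A: "A \<in> carrier_mat n n" "upper_triangular A" and B: "B \<in> carrier_mat n n" "upper_triangular B"
  shows "upper_triangular (A * B)"
    and "i < n \<Longrightarrow> (A * B) $$ (i, i) = A $$ (i, i) * B $$ (i, i)"
proof -
  have entry: "(A * B) $$ (i, j) = (\<Sum>l<n. A $$ (i, l) * B $$ (l, j))" if "i < n" "j < n" for i j
    using A B that by (simp add: scalar_prod_def atLeast0LessThan)
  have vanish: "A $$ (i, l) * B $$ (l, j) = 0" if "i < n" "l < n" "l < i \<or> j < l" for i l j
    using that upper_triangularD[OF A(2), of l i] upper_triangularD[OF B(2), of j l] A(1) B(1) by auto
  show "upper_triangular (A * B)"
  proof (rule upper_triangularI)
    fix i j assume "j < i" "i < dim_row (A * B)"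
    then have ij: "j < i" "i < n" "j < n" using A by auto
    then show "(A * B) $$ (i, j) = 0"
      unfolding entry[OF ij(2,3)] by (intro sum.neutral ballI vanish) auto
  qed
  show "(A * B) $$ (i, i) = A $$ (i, i) * B $$ (i, i)" if i: "i < n"
  proof -
    have "(A * B) $$ (i, i) = (\<Sum>l\<in>{i}. A $$ (i, l) * B $$ (l, i))"
      unfolding entry[OF i i] 
      by (rule sum.mono_neutral_right) (use i vanish[of i _ i] in \<open>auto simp: neq_iff\<close>)
    then show ?thesis by simp
  qed
qed

lemma upper_triangular_pow:
  fixes A :: "'a::comm_ring_1 mat"
  assumes A: "A \<in> carrier_mat n n" "upper_triangular A"
  shows "upper_triangular (A ^\<^sub>m k) \<and> (\<forall>i<n. (A ^\<^sub>m k) $$ (i, i) = A $$ (i, i) ^ k)"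
proof (induction k)
  case (Suc k)
  then show ?case
    using upper_triangular_mult[of "A ^\<^sub>m k" n A] A by (simp add: mult.commute)
qed (use A in simp)

lemma similar_mat_pow:
  assumes "similar_mat A B" shows "similar_mat (A ^\<^sub>m k) (B ^\<^sub>m k)"
  using assms similar_mat_wit_pow unfolding similar_mat_def by blast

lemma trace_pow_eq_power_sum:
  fixes A :: "'a::comm_ring_1 mat"
  assumes "A \<in> carrier_mat n n" "B \<in> carrier_mat n n" "upper_triangular B" "similar_mat A B"
  shows "trace (A ^\<^sub>m k) = (\<Sum>i<n. B $$ (i, i) ^ k)"
proof -
  have "trace (A ^\<^sub>m k) = trace (B ^\<^sub>m k)"
    using assms by (intro trace_similar[OF similar_mat_pow]) auto
  also have "\<dots> = (\<Sum>i<n. (B ^\<^sub>m k) $$ (i, i))"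
    using assms by (simp add: trace_def)
  finally show ?thesis using upper_triangular_pow[OF assms(2,3), of k] by simp
qed

lemma trace_nilpotent:
  fixes A :: "'k::alg_closed_field mat"
  assumes A: "A \<in> carrier_mat n n" and nil: "A ^\<^sub>m k = 0\<^sub>m n n"
  shows "trace A = 0"
proof -
  obtain B where B: "B \<in> carrier_mat n n" "upper_triangular B" "similar_mat A B"
    using similar_to_upper_triangular[OF A] by auto
  have "similar_mat (0\<^sub>m n n) (B ^\<^sub>m k)" using similar_mat_pow[OF B(3), of k] nil by simp
  then obtain P Q where "similar_mat_wit (B ^\<^sub>m k) (0\<^sub>m n n) P Q"
    using similar_mat_sym unfolding similar_mat_def by blast
  from similar_mat_witD2[OF pow_carrier_mat[OF B(1)] this] have "B ^\<^sub>m k = 0\<^sub>m n n" by auto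
  then have "B $$ (i, i) ^ k = 0" if "i < n" for i
    using upper_triangular_pow[OF B(1,2), of k] that by (metis index_zero_mat(1))
  then have "B $$ (i, i) = 0" if "i < n" for i using that by (metis power_not_zero)
  then show ?thesis
    using trace_similar[OF B(3) A] B(1) by (simp add: trace_def)
qed

text \<open>This is the implication from vanishing power sums to nilpotency, in the form that is used. The power
sums of the eigenvalues vanish, hence so does the sum of \<open>x q(x)\<close> over the eigenvalues \<open>x\<close> for every
polynomial \<open>q\<close>. If \<open>q\<close> vanishes at all eigenvalues other than 1, only the multiplicity of the
eigenvalue 1 times \<open>q(1)\<close> remains, and in characteristic 0 that multiplicity must be 0.\<close>

lemma no_fixed_vector_of_traceless_powers:
  fixes A :: "'k::alg_closed_field mat"
  assumes char_0: "\<And>m. m > 0 \<Longrightarrow> of_nat m \<noteq> (0 :: 'k)"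
    and A: "A \<in> carrier_mat n n" and tr: "\<And>k. k > 0 \<Longrightarrow> trace (A ^\<^sub>m k) = 0"
    and v: "v \<in> carrier_vec n" "A *\<^sub>v v = v"
  shows "v = 0\<^sub>v n"
proof (rule ccontr)
  assume "v \<noteq> 0\<^sub>v n"
  then have "eigenvalue A 1" using A v unfolding eigenvalue_def eigenvector_def by auto
  then have root: "poly (char_poly A) 1 = 0" using eigenvalue_root_char_poly[OF A] by simp
  obtain B where B: "B \<in> carrier_mat n n" "upper_triangular B" "similar_mat A B"
    using similar_to_upper_triangular[OF A] by auto
  define d where "d i = B $$ (i, i)" for i
  have "char_poly A = (\<Prod>a\<leftarrow>diag_mat B. [:- a, 1:])"
    using char_poly_similar[OF B(3)] char_poly_upper_triangular[OF B(1,2)] by simp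
  then have "\<exists>a\<in>set (diag_mat B). poly [:- a, 1:] 1 = 0"
    using root by (auto simp: poly_prod_list prod_list_zero_iff)
  then have ex: "\<exists>i<n. d i = 1" using B(1) by (auto simp: diag_mat_def d_def)
  have power_sums: "(\<Sum>i<n. d i ^ Suc k) = 0" for k
    using trace_pow_eq_power_sum[OF A B, of "Suc k"] tr[of "Suc k"] by (simp add: d_def)
  have sum_poly: "(\<Sum>i<n. d i * poly q (d i)) = 0" for q
  proof -
    have "(\<Sum>i<n. d i * poly q (d i)) = (\<Sum>i<n. \<Sum>j\<le>degree q. coeff q j * d i ^ Suc j)"
      by (simp add: poly_altdef sum_distrib_left mult.left_commute)
    also have "\<dots> = (\<Sum>j\<le>degree q. coeff q j * (\<Sum>i<n. d i ^ Suc j))"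
      by (subst sum.swap) (simp add: sum_distrib_left)
    finally show ?thesis by (simp only: power_sums) simp
  qed
  define S where "S = d ` {..<n} - {1}"
  define q where "q = (\<Prod>a\<in>S. [:- a, 1:])"
  have S: "finite S" by (simp add: S_def)
  have q1: "poly q 1 \<noteq> 0" using S by (auto simp: q_def poly_prod S_def)
  have q0: "poly q (d i) = 0" if "i < n" "d i \<noteq> 1" for i
    using S that by (auto simp: q_def poly_prod S_def)
  define I where "I = {i. i < n \<and> d i = 1}"
  have "(\<Sum>i<n. d i * poly q (d i)) = (\<Sum>i\<in>I. d i * poly q (d i))"
    by (rule sum.mono_neutral_right) (auto simp: I_def q0)
  also have "\<dots> = of_nat (card I) * poly q 1" by (simp add: I_def)
  finally have "of_nat (card I) = (0 :: 'k)" using sum_poly q1 by simp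
  moreover have "card I > 0" using ex by (auto simp: I_def card_gt_0_iff)
  ultimately show False using char_0 by blast
qed

text \<open>The ascending chain of subspaces in which \<open>fixed_flag n S (Suc m)\<close> consists of the vectors that
become fixed by \<open>S\<close> modulo \<open>fixed_flag n S m\<close>. Over a field, \<open>S\<close> is simultaneously unitriangular in some
basis if and only if the chain reaches the whole space.\<close>

fun fixed_flag :: "nat \<Rightarrow> 'a::comm_ring_1 mat set \<Rightarrow> nat \<Rightarrow> 'a vec set" where
  "fixed_flag n S 0 = {0\<^sub>v n}"
| "fixed_flag n S (Suc m) = {v \<in> carrier_vec n. \<forall>g\<in>S. (g - 1\<^sub>m n) *\<^sub>v v \<in> fixed_flag n S m}"

lemma fixed_flag_carrier: "fixed_flag n S m \<subseteq> carrier_vec n"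
  by (cases m) auto

lemma fixed_flag_zero:
  assumes "S \<subseteq> carrier_mat n n" shows "0\<^sub>v n \<in> fixed_flag n S m"
proof (induction m)
  case (Suc m)
  have "(g - 1\<^sub>m n) *\<^sub>v 0\<^sub>v n = 0\<^sub>v n" if "g \<in> S" for g
    using assms that by (intro eq_vecI) (auto simp: scalar_prod_def)
  then show ?case using Suc by simp
qed simp

lemma sub_one_mult:
  assumes g: "g \<in> carrier_mat n n" and h: "h \<in> carrier_mat n n"
  shows "(g - 1\<^sub>m n) * (h - 1\<^sub>m n) = g * h - g - h + (1\<^sub>m n :: 'a::comm_ring_1 mat)"
proof -
  have "(g - 1\<^sub>m n) * (h - 1\<^sub>m n) = g * (h - 1\<^sub>m n) - 1\<^sub>m n * (h - 1\<^sub>m n)"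
    using g h by (intro minus_mult_distrib_mat) auto
  also have "g * (h - 1\<^sub>m n) = g * h - g * 1\<^sub>m n"
    using g h by (intro mult_minus_distrib_mat) auto
  also have "g * h - g * 1\<^sub>m n - 1\<^sub>m n * (h - 1\<^sub>m n) = g * h - g - (h - 1\<^sub>m n)"
    using g h minus_carrier_mat[of "1\<^sub>m n" n n h] by simp
  also have "\<dots> = g * h - g - h + 1\<^sub>m n" using g h by (intro eq_matI) auto
  finally show ?thesis .
qed

text \<open>The linear span of the matrices \<open>g - 1\<close>. When \<open>S\<close> is closed under products, this is an algebra
without unit.\<close>

inductive_set augmentation :: "nat \<Rightarrow> 'a::comm_ring_1 mat set \<Rightarrow> 'a mat set" for n S where
  gen: "g \<in> S \<Longrightarrow> g - 1\<^sub>m n \<in> augmentation n S"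
| zero: "0\<^sub>m n n \<in> augmentation n S"
| add: "a \<in> augmentation n S \<Longrightarrow> b \<in> augmentation n S \<Longrightarrow> a + b \<in> augmentation n S"
| smult: "a \<in> augmentation n S \<Longrightarrow> c \<cdot>\<^sub>m a \<in> augmentation n S"

lemma augmentation_carrier:
  assumes "S \<subseteq> carrier_mat n n" "a \<in> augmentation n S"
  shows "a \<in> carrier_mat n n"
  using assms(2) by (induction rule: augmentation.induct) (use assms(1) in auto)

context
  fixes n :: nat and S :: "'k::field mat set"
  assumes S: "S \<subseteq> carrier_mat n n" and S_mult: "\<And>g h. g \<in> S \<Longrightarrow> h \<in> S \<Longrightarrow> g * h \<in> S"
begin

private lemmas aug_carrier = augmentation_carrier[OF S]

text \<open>On generators, \<open>(g - 1) (h - 1) = (g h - 1) - (g - 1) - (h - 1)\<close>.\<close>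

lemma augmentation_mult:
  assumes "a \<in> augmentation n S" "b \<in> augmentation n S"
  shows "a * b \<in> augmentation n S"
  using assms(1)
proof (induction rule: augmentation.induct)
  case (gen g)
  have g: "g \<in> carrier_mat n n" "g - 1\<^sub>m n \<in> carrier_mat n n"
    using gen S by (auto intro: minus_carrier_mat)
  show ?case using assms(2)
  proof (induction rule: augmentation.induct)
    case (gen h)
    have h: "h \<in> carrier_mat n n" using gen S by auto
    have "(g - 1\<^sub>m n) * (h - 1\<^sub>m n)
        = (g * h - 1\<^sub>m n) + ((-1) \<cdot>\<^sub>m (g - 1\<^sub>m n) + (-1) \<cdot>\<^sub>m (h - 1\<^sub>m n))"
      unfolding sub_one_mult[OF g(1) h] using g(1) h by (intro eq_matI) auto
    then show ?case using \<open>g \<in> S\<close> \<open>h \<in> S\<close> S_mult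
      by (auto intro!: augmentation.intros)
  next
    case (add a b)
    then show ?case using g
      by (simp add: mult_add_distrib_mat[of "g - 1\<^sub>m n" n n _ n] aug_carrier augmentation.add)
  next
    case (smult a c)
    then show ?case using g
      by (simp add: mult_smult_distrib[of "g - 1\<^sub>m n" n n _ n] aug_carrier augmentation.smult)
  qed (use g in \<open>auto intro: augmentation.zero\<close>)
next
  case zero
  then show ?case using aug_carrier[OF assms(2)] by (simp add: augmentation.zero)
next
  case (add a c)
  then show ?case
    using aug_carrier[OF assms(2)]
    by (simp add: add_mult_distrib_mat[of a n n _ _ n] aug_carrier augmentation.add)
next
  case (smult a c)
  then show ?case
    using aug_carrier[OF assms(2)]
    by (simp add: mult_smult_assoc_mat[of a n n _ n] aug_carrier augmentation.smult)
qed

lemma augmentation_pow: "a \<in> augmentation n S \<Longrightarrow> a ^\<^sub>m Suc k \<in> augmentation n S"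
proof (induction k)
  case 0
  then show ?case using aug_carrier by simp
qed (simp add: augmentation_mult)

end

text \<open>Any \<open>n + 1\<close> vectors in dimension \<open>n\<close>, even with repetitions, satisfy a nontrivial linear relation:
put them into the columns of a square matrix whose last row is 0.\<close>

lemma linear_dependence:
  fixes w :: "nat \<Rightarrow> 'k::field vec"
  shows "\<exists>c. (\<exists>j\<le>n. c j \<noteq> 0) \<and> (\<forall>i<n. (\<Sum>j\<le>n. c j * w j $ i) = 0)"
proof -
  define M where "M = mat (Suc n) (Suc n) (\<lambda>(i, j). if i < n then w j $ i else 0)"
  have M: "M \<in> carrier_mat (Suc n) (Suc n)" by (simp add: M_def)
  have "transpose_mat M *\<^sub>v unit_vec (Suc n) n = 0\<^sub>v (Suc n)"
    by (rule eq_vecI) (auto simp: M_def scalar_prod_def intro!: sum.neutral)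
  moreover have "unit_vec (Suc n) n \<noteq> (0\<^sub>v (Suc n) :: 'k vec)"
    by (metis index_unit_vec(1) index_zero_vec(1) lessI zero_neq_one)
  ultimately have "det (transpose_mat M) = 0"
    using det_0_iff_vec_prod_zero_field[of "transpose_mat M" "Suc n"] M unit_vec_carrier
    by (metis transpose_carrier_mat)
  then have "det M = 0" using det_transpose[OF M] by simp
  then obtain x where x: "x \<in> carrier_vec (Suc n)" "x \<noteq> 0\<^sub>v (Suc n)" "M *\<^sub>v x = 0\<^sub>v (Suc n)"
    using det_0_iff_vec_prod_zero_field[OF M] by auto
  have "(\<Sum>j\<le>n. x $ j * w j $ i) = 0" if "i < n" for i
  proof -
    have "0 = (M *\<^sub>v x) $ i" using x(3) that by simp
    also have "\<dots> = (\<Sum>j<Suc n. w j $ i * x $ j)"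
      using that x(1) by (simp add: M_def scalar_prod_def atLeast0LessThan del: sum.lessThan_Suc)
    finally show ?thesis by (simp add: mult.commute lessThan_Suc_atMost)
  qed
  moreover have "\<exists>j\<le>n. x $ j \<noteq> 0"
  proof (rule ccontr)
    assume "\<not> (\<exists>j\<le>n. x $ j \<noteq> 0)"
    then have "x = 0\<^sub>v (Suc n)" using x(1) by (intro eq_vecI) auto
    then show False using x(2) by simp
  qed
  ultimately show ?thesis by blast
qed

text \<open>All elements of the span \<open>A\<close> of the matrices \<open>g - 1\<close> have trace 0, and \<open>A\<close> is closed under products,
so all powers of an element of \<open>A\<close> have trace 0 and no element of \<open>A\<close> fixes a nonzero vector. If the
flag did not reach the whole space in \<open>n\<close> steps, there would be a chain of \<open>n + 1\<close> nonzero vectors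
in which each vector is the image of the next one under some \<open>g - 1\<close>. In a linear relation between
them, the last vector with a nonzero coefficient is a combination of earlier ones, that is, of its
images under \<open>A\<close>. This makes it a fixed vector of an element of \<open>A\<close>.\<close>

theorem kolchin:
  fixes S :: "'k::alg_closed_field mat set"
  assumes char_0: "\<And>m. m > 0 \<Longrightarrow> of_nat m \<noteq> (0 :: 'k)"
    and S_mult: "\<And>g h. g \<in> S \<Longrightarrow> h \<in> S \<Longrightarrow> g * h \<in> S"
    and unipotent: "\<And>g. g \<in> S \<Longrightarrow> unipotent_matrix n g"
  shows "fixed_flag n S n = carrier_vec n"
proof (rule ccontr)
  have S: "S \<subseteq> carrier_mat n n" using unipotent by (auto simp: unipotent_matrix_def)
  note aug_carrier = augmentation_carrier[OF S]
  have aug_mult: "a * b \<in> augmentation n S"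
    if "a \<in> augmentation n S" "b \<in> augmentation n S" for a b
    using that by (intro augmentation_mult[OF S]) (auto intro: S_mult)
  have trace_zero: "trace a = 0" if "a \<in> augmentation n S" for a
    using that
  proof (induction rule: augmentation.induct)
    case (gen g)
    then obtain k where "g \<in> carrier_mat n n" "(g - 1\<^sub>m n) ^\<^sub>m k = 0\<^sub>m n n"
      using unipotent[OF gen] by (auto simp: unipotent_matrix_def)
    then show ?case by (intro trace_nilpotent[of _ n]) (auto intro: minus_carrier_mat)
  next
    case zero
    show ?case by (simp add: trace_def)
  next
    case (add a b)
    then show ?case using trace_add[OF aug_carrier aug_carrier] by simp
  next
    case (smult a c)
    then show ?case using trace_smult[OF aug_carrier] by simp
  qed
  have no_fixed: "v = 0\<^sub>v n" if "a \<in> augmentation n S" "v \<in> carrier_vec n" "a *\<^sub>v v = v" for a v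
  proof (rule no_fixed_vector_of_traceless_powers[OF char_0 aug_carrier[OF that(1)] _ that(2,3)])
    fix k :: nat assume "k > 0"
    have "a ^\<^sub>m Suc (k - 1) \<in> augmentation n S"
      using that(1) by (intro augmentation_pow[OF S]) (auto intro: S_mult)
    then show "trace (a ^\<^sub>m k) = 0" using trace_zero \<open>k > 0\<close> by simp
  qed
  have chain: "\<exists>w. w m = v \<and> (\<forall>j\<le>m. w j \<in> carrier_vec n \<and> w j \<noteq> 0\<^sub>v n) \<and>
      (\<forall>i j. i < j \<and> j \<le> m \<longrightarrow> (\<exists>a\<in>augmentation n S. w i = a *\<^sub>v w j))"
    if "v \<in> carrier_vec n" "v \<notin> fixed_flag n S m" for v m
    using that
  proof (induction m arbitrary: v)
    case 0
    then show ?case by (intro exI[of _ "\<lambda>_. v"]) auto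
  next
    case (Suc m)
    have v: "v \<in> carrier_vec n" "v \<noteq> 0\<^sub>v n" using Suc.prems fixed_flag_zero[OF S] by metis+
    obtain g where g: "g \<in> S" "(g - 1\<^sub>m n) *\<^sub>v v \<notin> fixed_flag n S m"
      using Suc.prems by auto
    have gc: "g \<in> carrier_mat n n" using g S by auto
    obtain w where w: "w m = (g - 1\<^sub>m n) *\<^sub>v v"
      "\<And>j. j \<le> m \<Longrightarrow> w j \<in> carrier_vec n \<and> w j \<noteq> 0\<^sub>v n"
      "\<And>i j. i < j \<Longrightarrow> j \<le> m \<Longrightarrow> \<exists>a\<in>augmentation n S. w i = a *\<^sub>v w j"
      using Suc.IH[OF _ g(2)] gc v by (metis minus_carrier_mat mult_mat_vec_carrier one_carrier_mat)
    have "\<exists>a\<in>augmentation n S. w i = a *\<^sub>v v" if i: "i < Suc m" for i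
    proof (cases "i = m")
      case True
      then show ?thesis using w(1) g(1) augmentation.gen by metis
    next
      case False
      then obtain a where a: "a \<in> augmentation n S" "w i = a *\<^sub>v w m" using w(3)[of i m] i by auto
      then have "w i = (a * (g - 1\<^sub>m n)) *\<^sub>v v"
        using w(1) aug_carrier[OF a(1)] v gc by (simp add: assoc_mult_mat_vec[of a n n "g - 1\<^sub>m n" n v] minus_carrier_mat)
      then show ?thesis using aug_mult[OF a(1) augmentation.gen[OF g(1)]] by blast
    qed
    then show ?case using w v
      by (intro exI[of _ "w(Suc m := v)"]) (auto simp: less_Suc_eq_le le_Suc_eq)
  qed
  assume "fixed_flag n S n \<noteq> carrier_vec n"
  then obtain v0 where "v0 \<in> carrier_vec n" "v0 \<notin> fixed_flag n S n"
    using fixed_flag_carrier by blast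
  then obtain w where w: "\<And>j. j \<le> n \<Longrightarrow> w j \<in> carrier_vec n" "\<And>j. j \<le> n \<Longrightarrow> w j \<noteq> 0\<^sub>v n"
    and w_aug: "\<And>i j. i < j \<Longrightarrow> j \<le> n \<Longrightarrow> \<exists>a\<in>augmentation n S. w i = a *\<^sub>v w j"
    using chain[of v0 n] by blast
  obtain c where c: "\<exists>j\<le>n. c j \<noteq> (0::'k)" "\<And>i. i < n \<Longrightarrow> (\<Sum>j\<le>n. c j * w j $ i) = 0"
    using linear_dependence[of n w] by blast
  \<comment> \<open>The vectors before \<open>w J\<close> are images of it under \<open>A\<close>, so the relation turns into \<open>b (w J) = w J\<close>.\<close>
  define J where "J = Max {j. j \<le> n \<and> c j \<noteq> 0}"
  have "J \<in> {j. j \<le> n \<and> c j \<noteq> 0}" unfolding J_def using c(1) by (intro Max_in) auto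
  then have J: "J \<le> n" "c J \<noteq> 0" by auto
  have J_max: "c j = 0" if "J < j" "j \<le> n" for j
    using that Max_ge[of "{j. j \<le> n \<and> c j \<noteq> 0}" j] unfolding J_def by fastforce
  have comb: "\<exists>b\<in>augmentation n S. \<forall>i<n. (b *\<^sub>v w J) $ i = (\<Sum>j<m. - c j / c J * w j $ i)"
    if "m \<le> J" for m
    using that
  proof (induction m)
    case 0
    have "(0\<^sub>m n n *\<^sub>v w J) $ i = 0" if "i < n" for i using that w(1)[OF J(1)] by simp
    then show ?case using augmentation.zero by (intro bexI[of _ "0\<^sub>m n n"]) auto
  next
    case (Suc m)
    then obtain b where b: "b \<in> augmentation n S"
      "\<And>i. i < n \<Longrightarrow> (b *\<^sub>v w J) $ i = (\<Sum>j<m. - c j / c J * w j $ i)" by auto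
    obtain a where a: "a \<in> augmentation n S" "w m = a *\<^sub>v w J" using w_aug[of m J] Suc.prems J by auto
    let ?b = "b + (- c m / c J) \<cdot>\<^sub>m a"
    have "(?b *\<^sub>v w J) $ i = (\<Sum>j<Suc m. - c j / c J * w j $ i)" if i: "i < n" for i
    proof -
      have "?b *\<^sub>v w J = b *\<^sub>v w J + (- c m / c J) \<cdot>\<^sub>v (a *\<^sub>v w J)"
        using aug_carrier[OF a(1)] aug_carrier[OF b(1)] w(1)[OF J(1)]
        by (intro eq_vecI) (auto simp: add_mult_distrib_mat_vec[of b n n])
      then show ?thesis
        using b(2)[OF i] aug_carrier[OF a(1)] aug_carrier[OF b(1)] i by (simp add: a(2))
    qed
    then show ?case using a b by (intro bexI[of _ ?b]) (auto intro: augmentation.intros)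
  qed
  obtain b where b: "b \<in> augmentation n S"
    "\<And>i. i < n \<Longrightarrow> (b *\<^sub>v w J) $ i = (\<Sum>j<J. - c j / c J * w j $ i)"
    using comb[of J] by auto
  have "b *\<^sub>v w J = w J"
  proof (rule eq_vecI)
    fix i assume "i < dim_vec (w J)"
    then have i: "i < n" using w(1)[OF J(1)] by simp
    have "(\<Sum>j\<le>J. c j * w j $ i) = (\<Sum>j\<le>n. c j * w j $ i)"
      by (rule sum.mono_neutral_left) (use J J_max in auto)
    also have "\<dots> = 0" using c(2)[OF i] .
    finally have "c J * w J $ i = - (\<Sum>j<J. c j * w j $ i)"
      by (simp add: lessThan_Suc_atMost[symmetric] add_eq_0_iff)
    then have "w J $ i = (\<Sum>j<J. - c j / c J * w j $ i)"
      using J(2) by (simp add: sum_divide_distrib[symmetric] sum_negf field_simps)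
    then show "(b *\<^sub>v w J) $ i = w J $ i" using b(2)[OF i] by simp
  qed (use aug_carrier[OF b(1)] w(1)[OF J(1)] in auto)
  then show False using no_fixed[OF b(1) w(1)[OF J(1)]] w(2)[OF J(1)] by simp
qed

section \<open>Polynomial functions and interpolation at the natural numbers\<close>

text \<open>Functions that are polynomial after the change of fields \<open>\<iota>\<close>. With \<open>\<iota> = id\<close> they are the polynomial
functions on one field; a general \<open>\<iota>\<close> is used to evaluate equations over the large field along a
curve over the small one.\<close>

definition polynomial_in :: "('l \<Rightarrow> 'k::comm_ring_1) \<Rightarrow> ('l \<Rightarrow> 'k) \<Rightarrow> bool" where
  "polynomial_in \<iota> F \<longleftrightarrow> (\<exists>q. \<forall>t. F t = poly q (\<iota> t))"

lemma polynomial_in_const: "polynomial_in \<iota> (\<lambda>t. c)"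
  unfolding polynomial_in_def by (rule exI[of _ "[:c:]"]) simp

lemma polynomial_in_id: "polynomial_in id (\<lambda>t. t)"
  unfolding polynomial_in_def by (rule exI[of _ "[:0, 1:]"]) simp

lemma polynomial_in_add:
  "polynomial_in \<iota> F \<Longrightarrow> polynomial_in \<iota> G \<Longrightarrow> polynomial_in \<iota> (\<lambda>t. F t + G t)"
  unfolding polynomial_in_def by (metis poly_add)

lemma polynomial_in_diff:
  "polynomial_in \<iota> F \<Longrightarrow> polynomial_in \<iota> G \<Longrightarrow> polynomial_in \<iota> (\<lambda>t. F t - G t)"
  unfolding polynomial_in_def by (metis poly_diff)

lemma polynomial_in_mult:
  "polynomial_in \<iota> F \<Longrightarrow> polynomial_in \<iota> G \<Longrightarrow> polynomial_in \<iota> (\<lambda>t. F t * G t)"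
  unfolding polynomial_in_def by (metis poly_mult)

lemma polynomial_in_power: "polynomial_in \<iota> F \<Longrightarrow> polynomial_in \<iota> (\<lambda>t. F t ^ k)"
  unfolding polynomial_in_def by (metis poly_power)

lemma polynomial_in_sum:
  "(\<And>j. j \<in> J \<Longrightarrow> polynomial_in \<iota> (F j)) \<Longrightarrow> polynomial_in \<iota> (\<lambda>t. \<Sum>j\<in>J. F j t)"
  by (induction J rule: infinite_finite_induct)
    (auto intro: polynomial_in_const polynomial_in_add)

lemma polynomial_in_prod:
  "(\<And>j. j \<in> J \<Longrightarrow> polynomial_in \<iota> (F j)) \<Longrightarrow> polynomial_in \<iota> (\<lambda>t. \<Prod>j\<in>J. F j t)"
  by (induction J rule: infinite_finite_induct)
    (auto intro: polynomial_in_const polynomial_in_mult)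

lemma polynomial_in_compose:
  "polynomial_in id F \<Longrightarrow> polynomial_in \<iota> g \<Longrightarrow> polynomial_in \<iota> (\<lambda>t. F (g t))"
  unfolding polynomial_in_def by (metis id_apply poly_pcompose)

lemma polynomial_in_gbinomial:
  "polynomial_in id (\<lambda>t::'l::field_char_0. t gchoose k)"
proof -
  have "(\<lambda>t::'l. t gchoose k) = (\<lambda>t. inverse (fact k) * (\<Prod>i = 0..<k. id t - of_nat i))"
    by (simp add: gbinomial_prod_rev field_simps)
  then show ?thesis
    by (auto intro!: polynomial_in_mult polynomial_in_prod polynomial_in_const polynomial_in_diff
        polynomial_in_id)
qed

lemma polynomial_in_eq_zero:
  fixes \<iota> :: "'l::field_char_0 \<Rightarrow> 'k::field"
  assumes \<iota>: "field_hom \<iota>" and F: "polynomial_in \<iota> F" and zero: "\<And>m::nat. F (of_nat m) = 0"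
  shows "F t = 0"
proof -
  interpret field_hom \<iota> by fact
  obtain q where q: "\<And>t. F t = poly q (\<iota> t)" using F by (auto simp: polynomial_in_def)
  have "inj (\<lambda>m::nat. \<iota> (of_nat m))" by (rule injI) simp
  then have "infinite (range (\<lambda>m::nat. \<iota> (of_nat m)))" by (rule range_inj_infinite)
  moreover have "range (\<lambda>m::nat. \<iota> (of_nat m)) \<subseteq> {z. poly q z = 0}" using zero q by auto
  ultimately have "infinite {z. poly q z = 0}" using finite_subset by blast
  then have "q = 0" using poly_roots_finite by blast
  then show ?thesis using q by simp
qed

lemma field_hom_id: "field_hom (id :: 'l::field \<Rightarrow> 'l)"
  by unfold_locales auto

lemma polynomial_in_unique:
  fixes F G :: "'l::field_char_0 \<Rightarrow> 'l"
  assumes "polynomial_in id F" "polynomial_in id G" "\<And>m::nat. F (of_nat m) = G (of_nat m)"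
  shows "F t = G t"
  using polynomial_in_eq_zero[OF field_hom_id polynomial_in_diff[OF assms(1,2)]] assms(3) by simp

text \<open>The nodes are the natural numbers below \<open>d\<close>, which are distinct in characteristic 0. A polynomial of
degree below \<open>d\<close> and its interpolating polynomial differ by a polynomial with \<open>d\<close> roots.\<close>

lemma lagrange_interpolation:
  obtains l :: "nat \<Rightarrow> 'l::field_char_0 poly"
  where "\<And>p t. degree p < d \<Longrightarrow> poly p t = (\<Sum>j<d. poly (l j) t * poly p (of_nat j))"
proof
  define w :: "nat \<Rightarrow> 'l poly" where "w j = (\<Prod>i\<in>{..<d} - {j}. [:- of_nat i, 1:])" for j
  define l where "l j = Polynomial.smult (inverse (poly (w j) (of_nat j))) (w j)" for j
  have deg: "degree (w j) < d" if "j < d" for j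
  proof -
    have "degree (w j) \<le> (\<Sum>i\<in>{..<d} - {j}. degree [:- of_nat i, 1 :: 'l:])"
      unfolding w_def
      using degree_prod_sum_le[of "{..<d} - {j}" "\<lambda>i. [:- of_nat i, 1 :: 'l:]"] by (simp add: o_def)
    also have "\<dots> = d - 1" using that by simp
    finally show ?thesis using that by simp
  qed
  have w_zero: "poly (w j) (of_nat i) = 0" if "i < d" "i \<noteq> j" for i j
    using that by (auto simp: w_def poly_prod)
  have w_nonzero: "poly (w j) (of_nat j) \<noteq> 0" for j by (auto simp: w_def poly_prod)
  have l_at: "poly (l j) (of_nat i) = (if i = j then 1 else 0)" if "i < d" for i j
    using w_zero[OF that] w_nonzero by (simp add: l_def)
  fix p :: "'l poly" and t assume p: "degree p < d"
  define r where "r = p - (\<Sum>j<d. Polynomial.smult (poly p (of_nat j)) (l j))"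
  have "degree (\<Sum>j<d. Polynomial.smult (poly p (of_nat j)) (l j)) < d"
    using deg p by (intro degree_sum_less) (auto simp: l_def intro: le_less_trans[OF Polynomial.degree_smult_le])
  then have "degree r < d" using p by (simp add: r_def degree_diff_less)
  moreover have "poly r (of_nat i) = 0" if "i < d" for i
    using that by (simp add: r_def poly_sum l_at[OF that] if_distrib cong: if_cong)
  then have "of_nat ` {..<d} \<subseteq> {x. poly r x = 0}" by auto
  ultimately have "r = 0"
  proof (rule_tac ccontr)
    assume r: "r \<noteq> 0" and "degree r < d" and sub: "of_nat ` {..<d} \<subseteq> {x. poly r x = 0}"
    have "d = card ((of_nat :: nat \<Rightarrow> 'l) ` {..<d})" by (simp add: card_image)
    also have "\<dots> \<le> card {x. poly r x = 0}" using poly_roots_finite[OF r] sub by (rule card_mono)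
    also have "\<dots> \<le> degree r" using r by (rule card_poly_roots_bound)
    finally show False using \<open>degree r < d\<close> by simp
  qed
  then have "p = (\<Sum>j<d. Polynomial.smult (poly p (of_nat j)) (l j))" by (simp add: r_def)
  then have "poly p t = poly (\<Sum>j<d. Polynomial.smult (poly p (of_nat j)) (l j)) t" by simp
  then show "poly p t = (\<Sum>j<d. poly (l j) t * poly p (of_nat j))"
    by (simp add: poly_sum mult.commute)
qed

section \<open>Binomial powers of a matrix\<close>

definition mat_lincomb :: "nat \<Rightarrow> nat set \<Rightarrow> (nat \<Rightarrow> 'a::comm_ring_1) \<Rightarrow> (nat \<Rightarrow> 'a mat) \<Rightarrow> 'a mat" where
  "mat_lincomb n J c M = mat n n (\<lambda>p. \<Sum>j\<in>J. c j * M j $$ p)"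

lemma mat_lincomb_carrier [simp]: "mat_lincomb n J c M \<in> carrier_mat n n"
  by (simp add: mat_lincomb_def)

lemma mat_lincomb_index [simp]:
  "i < n \<Longrightarrow> j < n \<Longrightarrow> mat_lincomb n J c M $$ (i, j) = (\<Sum>k\<in>J. c k * M k $$ (i, j))"
  by (simp add: mat_lincomb_def)

lemma mat_lincomb_dim [simp]:
  "dim_row (mat_lincomb n J c M) = n" "dim_col (mat_lincomb n J c M) = n"
  by (simp_all add: mat_lincomb_def)

lemma mat_lincomb_insert:
  "finite J \<Longrightarrow> k \<notin> J \<Longrightarrow> M k \<in> carrier_mat n n \<Longrightarrow>
    mat_lincomb n (insert k J) c M = c k \<cdot>\<^sub>m M k + mat_lincomb n J c M"
  by (rule eq_matI) auto

lemma mat_lincomb_mult_right: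
  assumes "\<And>k. M k \<in> carrier_mat n n" "Y \<in> carrier_mat n n"
  shows "mat_lincomb n J c M * Y = mat_lincomb n J c (\<lambda>k. M k * Y)"
proof (rule eq_matI)
  fix i j assume "i < dim_row (mat_lincomb n J c (\<lambda>k. M k * Y))"
    "j < dim_col (mat_lincomb n J c (\<lambda>k. M k * Y))"
  then have ij: "i < n" "j < n" by simp_all
  have "(mat_lincomb n J c M * Y) $$ (i, j) = (\<Sum>l<n. \<Sum>k\<in>J. c k * (M k $$ (i, l) * Y $$ (l, j)))"
    using assms(2) ij by (simp add: scalar_prod_def atLeast0LessThan sum_distrib_right mult.assoc)
  also have "\<dots> = (\<Sum>k\<in>J. c k * (\<Sum>l<n. M k $$ (i, l) * Y $$ (l, j)))"
    by (subst sum.swap) (simp add: sum_distrib_left)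
  also have "\<dots> = mat_lincomb n J c (\<lambda>k. M k * Y) $$ (i, j)"
  proof -
    have "(M k * Y) $$ (i, j) = (\<Sum>l<n. M k $$ (i, l) * Y $$ (l, j))" for k
      using assms(2) assms(1)[of k] ij by (simp add: scalar_prod_def atLeast0LessThan)
    then show ?thesis using ij by simp
  qed
  finally show "(mat_lincomb n J c M * Y) $$ (i, j) = mat_lincomb n J c (\<lambda>k. M k * Y) $$ (i, j)" .
qed (use assms(2) in auto)

text \<open>The binomial series of \<open>x = 1 + X\<close> with exponent \<open>t\<close>. For unipotent \<open>x\<close> the powers of \<open>X\<close> from \<open>X\<^sup>n\<close>
on vanish. The summation goes up to \<open>Suc n\<close> so that the linear term is present also for \<open>n = 0\<close>.\<close>

definition binomial_power :: "nat \<Rightarrow> 'l::field_char_0 mat \<Rightarrow> 'l \<Rightarrow> 'l mat" where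
  "binomial_power n x t = mat_lincomb n {..Suc n} (\<lambda>k. t gchoose k) (\<lambda>k. (x - 1\<^sub>m n) ^\<^sub>m k)"

lemma binomial_power_carrier [simp]: "binomial_power n x t \<in> carrier_mat n n"
  by (simp add: binomial_power_def)

definition polynomial_matrix :: "nat \<Rightarrow> ('l::comm_ring_1 \<Rightarrow> 'l mat) \<Rightarrow> bool" where
  "polynomial_matrix n f \<longleftrightarrow> (\<forall>t. f t \<in> carrier_mat n n) \<and>
     (\<forall>i<n. \<forall>j<n. polynomial_in id (\<lambda>t. f t $$ (i, j)))"

lemma polynomial_matrix_carrier: "polynomial_matrix n f \<Longrightarrow> f t \<in> carrier_mat n n"
  by (simp add: polynomial_matrix_def)

lemma polynomial_matrix_const: "A \<in> carrier_mat n n \<Longrightarrow> polynomial_matrix n (\<lambda>t. A)"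
  by (simp add: polynomial_matrix_def polynomial_in_const)

lemma polynomial_matrix_mult:
  assumes "polynomial_matrix n f" "polynomial_matrix n g"
  shows "polynomial_matrix n (\<lambda>t. f t * g t)"
  unfolding polynomial_matrix_def
proof (intro conjI allI impI)
  show "f t * g t \<in> carrier_mat n n" for t
    using assms by (auto simp: polynomial_matrix_def intro: mult_carrier_mat)
  fix i j assume ij: "i < n" "j < n"
  have "(\<lambda>t. (f t * g t) $$ (i, j)) = (\<lambda>t. \<Sum>l<n. f t $$ (i, l) * g t $$ (l, j))"
  proof
    fix t
    show "(f t * g t) $$ (i, j) = (\<Sum>l<n. f t $$ (i, l) * g t $$ (l, j))"
      using polynomial_matrix_carrier[OF assms(1), of t] polynomial_matrix_carrier[OF assms(2), of t] ij
      by (simp add: scalar_prod_def atLeast0LessThan)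
  qed
  then show "polynomial_in id (\<lambda>t. (f t * g t) $$ (i, j))"
    using assms ij by (auto simp: polynomial_matrix_def intro!: polynomial_in_sum polynomial_in_mult)
qed

lemma polynomial_matrix_sub_one:
  assumes "polynomial_matrix n f" shows "polynomial_matrix n (\<lambda>t. f t - 1\<^sub>m n)"
  using assms
  by (auto simp: polynomial_matrix_def minus_carrier_mat intro!: polynomial_in_diff polynomial_in_const)

lemma polynomial_matrix_pow:
  assumes "polynomial_matrix n f" shows "polynomial_matrix n (\<lambda>t. f t ^\<^sub>m k)"
proof (induction k)
  case 0
  have "f t ^\<^sub>m 0 = 1\<^sub>m n" for t using polynomial_matrix_carrier[OF assms, of t] by simp
  then show ?case by (simp only:) (simp add: polynomial_matrix_const)
qed (simp add: polynomial_matrix_mult assms)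

text \<open>In particular inverses of polynomial maps are polynomial, as the case of the exponent -1.\<close>

lemma polynomial_matrix_binomial_power:
  assumes f: "polynomial_matrix n f" and c: "polynomial_in id c"
  shows "polynomial_matrix n (\<lambda>t. binomial_power n (f t) (c t))"
  unfolding polynomial_matrix_def
proof (intro conjI allI impI)
  fix i j assume ij: "i < n" "j < n"
  have pow: "polynomial_in id (\<lambda>t. ((f t - 1\<^sub>m n) ^\<^sub>m k) $$ (i, j))" for k
    using polynomial_matrix_pow[OF polynomial_matrix_sub_one[OF f]] ij
    by (simp add: polynomial_matrix_def)
  show "polynomial_in id (\<lambda>t. binomial_power n (f t) (c t) $$ (i, j))"
    unfolding binomial_power_def mat_lincomb_index[OF ij]
    by (intro polynomial_in_sum polynomial_in_mult pow polynomial_in_compose[OF polynomial_in_gbinomial c])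
qed simp

lemma polynomial_matrix_unique:
  assumes f: "polynomial_matrix n f" and g: "polynomial_matrix n g"
    and eq: "\<And>m::nat. f (of_nat m) = g (of_nat m)"
  shows "f t = (g t :: 'l::field_char_0 mat)"
proof (rule eq_matI)
  fix i j assume "i < dim_row (g t)" "j < dim_col (g t)"
  then have ij: "i < n" "j < n" using polynomial_matrix_carrier[OF g, of t] by auto
  show "f t $$ (i, j) = g t $$ (i, j)"
    using f g ij eq polynomial_in_unique[of "\<lambda>t. f t $$ (i, j)" "\<lambda>t. g t $$ (i, j)" t]
    by (simp add: polynomial_matrix_def)
qed (use polynomial_matrix_carrier[OF f, of t] polynomial_matrix_carrier[OF g, of t] in auto)

section \<open>The filtration defined by the flag\<close>

lemma mat_eq_zero_of_vec:
  assumes "X \<in> carrier_mat n n" and "\<And>v. v \<in> carrier_vec n \<Longrightarrow> X *\<^sub>v v = (0\<^sub>v n :: 'a::comm_ring_1 vec)"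
  shows "X = 0\<^sub>m n n"
proof (rule eq_matI)
  fix i j assume "i < dim_row (0\<^sub>m n n)" "j < dim_col (0\<^sub>m n n)"
  then have ij: "i < n" "j < n" by simp_all
  have "X $$ (i, j) = (X *\<^sub>v unit_vec n j) $ i" using assms(1) ij by simp
  also have "\<dots> = 0" using assms(2)[OF unit_vec_carrier, of j] ij by simp
  finally show "X $$ (i, j) = 0\<^sub>m n n $$ (i, j)" using ij by simp
qed (use assms(1) in auto)

text \<open>The matrices that lower the flag of \<open>S\<close> by \<open>k\<close> steps: block triangular matrices with zeros on the
first \<open>k\<close> block diagonals. Describing them by their action on the flag makes the filtration
multiplicative without a choice of basis.\<close>

definition lowering :: "nat \<Rightarrow> 'a::comm_ring_1 mat set \<Rightarrow> nat \<Rightarrow> 'a mat set" where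
  "lowering n S k =
     {X \<in> carrier_mat n n. \<forall>m. \<forall>v\<in>fixed_flag n S (m + k). X *\<^sub>v v \<in> fixed_flag n S m}"

context
  fixes n :: nat and S :: "'l::field_char_0 mat set"
  assumes S: "S \<subseteq> carrier_mat n n"
begin

lemma fixed_flag_subspace:
  shows "u \<in> fixed_flag n S m \<Longrightarrow> v \<in> fixed_flag n S m \<Longrightarrow> u + v \<in> fixed_flag n S m"
    and "u \<in> fixed_flag n S m \<Longrightarrow> c \<cdot>\<^sub>v u \<in> fixed_flag n S m"
proof (induction m arbitrary: u v)
  case 0
  { case 1 then show ?case by simp }
  { case 2 then show ?case by (auto intro: eq_vecI) }
next
  case (Suc m)
  have g: "g - 1\<^sub>m n \<in> carrier_mat n n" if "g \<in> S" for g
    using S that by (auto intro: minus_carrier_mat)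
  { case 1
    then show ?case using Suc g by (auto simp: mult_add_distrib_mat_vec[of _ n n]) }
  { case 2
    then show ?case using Suc g by (auto simp: mult_mat_vec[of _ n n]) }
qed

lemma fixed_flag_mono: "m \<le> k \<Longrightarrow> fixed_flag n S m \<subseteq> fixed_flag n S k"
proof (induction rule: dec_induct)
  case (step k)
  have "fixed_flag n S k \<subseteq> fixed_flag n S (Suc k)" for k
  proof (induction k)
    case 0
    show ?case using fixed_flag_zero[OF S, of 1] by simp
  next
    case (Suc k)
    then show ?case by auto
  qed
  then show ?case using step by blast
qed simp

lemma lowering_carrier: "X \<in> lowering n S k \<Longrightarrow> X \<in> carrier_mat n n"
  by (simp add: lowering_def)

lemma lowering_gen: "g \<in> S \<Longrightarrow> g - 1\<^sub>m n \<in> lowering n S 1"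
  using S by (auto simp: lowering_def intro: minus_carrier_mat)

lemma lowering_zero: "0\<^sub>m n n \<in> lowering n S k"
proof -
  have "0\<^sub>m n n *\<^sub>v v = 0\<^sub>v n" if "v \<in> fixed_flag n S m" for v m
    using subsetD[OF fixed_flag_carrier that] by (intro eq_vecI) auto
  then show ?thesis using fixed_flag_zero[OF S] by (simp add: lowering_def)
qed

lemma lowering_one: "1\<^sub>m n \<in> lowering n S 0"
proof -
  have "1\<^sub>m n *\<^sub>v v = v" if "v \<in> fixed_flag n S m" for v m
    using subsetD[OF fixed_flag_carrier that] by (rule one_mult_mat_vec)
  then show ?thesis by (simp add: lowering_def)
qed

lemma lowering_add: "X \<in> lowering n S k \<Longrightarrow> Y \<in> lowering n S k \<Longrightarrow> X + Y \<in> lowering n S k"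
  unfolding lowering_def
proof (intro CollectI conjI allI ballI, goal_cases)
  case (2 m v)
  then have "v \<in> carrier_vec n" using fixed_flag_carrier by auto
  then show ?case using 2 fixed_flag_subspace(1) by (auto simp: add_mult_distrib_mat_vec[of _ n n])
qed auto

lemma lowering_smult: "X \<in> lowering n S k \<Longrightarrow> c \<cdot>\<^sub>m X \<in> lowering n S k"
  unfolding lowering_def
proof (intro CollectI conjI allI ballI, goal_cases)
  case (2 m v)
  then have v: "v \<in> carrier_vec n" using fixed_flag_carrier by auto
  then have "(c \<cdot>\<^sub>m X) *\<^sub>v v = c \<cdot>\<^sub>v (X *\<^sub>v v)" using 2 by (intro eq_vecI) auto
  then show ?case using 2 fixed_flag_subspace(2) by auto
qed auto

lemma lowering_diff: "X \<in> lowering n S k \<Longrightarrow> Y \<in> lowering n S k \<Longrightarrow> X - Y \<in> lowering n S k"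
proof -
  assume X: "X \<in> lowering n S k" and Y: "Y \<in> lowering n S k"
  have "X - Y = X + (-1) \<cdot>\<^sub>m Y"
    using lowering_carrier[OF X] lowering_carrier[OF Y] by (intro eq_matI) auto
  then show ?thesis using X Y lowering_add lowering_smult by metis
qed

lemma lowering_mult: "X \<in> lowering n S j \<Longrightarrow> Y \<in> lowering n S k \<Longrightarrow> X * Y \<in> lowering n S (j + k)"
  unfolding lowering_def
proof (intro CollectI conjI allI ballI, goal_cases)
  case (2 m v)
  then have v: "v \<in> carrier_vec n" using fixed_flag_carrier by auto
  have "Y *\<^sub>v v \<in> fixed_flag n S (m + j)" using 2 by (simp add: add.assoc)
  then have "X *\<^sub>v (Y *\<^sub>v v) \<in> fixed_flag n S m" using 2 by simp
  then show ?case using 2 v by (simp add: assoc_mult_mat_vec[of X n n Y n v])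
qed auto

lemma lowering_antimono: "X \<in> lowering n S k \<Longrightarrow> j \<le> k \<Longrightarrow> X \<in> lowering n S j"
  using fixed_flag_mono by (auto simp: lowering_def) (meson add_left_mono subsetD)

lemma lowering_mat_lincomb:
  assumes "finite J" "\<And>j. j \<in> J \<Longrightarrow> M j \<in> lowering n S k"
  shows "mat_lincomb n J c M \<in> lowering n S k"
  using assms
proof (induction J rule: finite_induct)
  case empty
  have "mat_lincomb n {} c M = 0\<^sub>m n n" by (rule eq_matI) auto
  then show ?case by (simp add: lowering_zero)
next
  case (insert j J)
  then have "M j \<in> lowering n S k" "mat_lincomb n J c M \<in> lowering n S k" by auto
  then show ?case
    using mat_lincomb_insert[OF insert(1,2), of M n c] lowering_carrier
    by (simp add: lowering_add lowering_smult)
qed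

lemma lowering_pow:
  assumes X: "X \<in> lowering n S k" and k: "1 \<le> k"
  shows "X ^\<^sub>m Suc m \<in> lowering n S k" and "X ^\<^sub>m Suc (Suc m) \<in> lowering n S (Suc k)"
proof -
  show *: "X ^\<^sub>m Suc m \<in> lowering n S k" for m
  proof (induction m)
    case 0
    show ?case using X lowering_carrier[OF X] by simp
  next
    case (Suc m)
    have "X ^\<^sub>m Suc m * X \<in> lowering n S k"
      using lowering_mult[OF Suc X] by (rule lowering_antimono) simp
    then show ?case by simp
  qed
  have "X ^\<^sub>m Suc m * X \<in> lowering n S (Suc k)"
    using lowering_mult[OF * X] by (rule lowering_antimono) (use k in simp)
  then show "X ^\<^sub>m Suc (Suc m) \<in> lowering n S (Suc k)" by simp
qed

text \<open>The terms of the binomial series after the linear one contain at least two factors \<open>x - 1\<close>, and with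
\<open>k \<ge> 1\<close> a product of two of them lies at least one level deeper.\<close>

lemma binomial_power_lowering:
  assumes x: "x \<in> carrier_mat n n" "x - 1\<^sub>m n \<in> lowering n S k" and k: "1 \<le> k"
  shows "binomial_power n x t - 1\<^sub>m n \<in> lowering n S k"
    and "binomial_power n x t - 1\<^sub>m n - t \<cdot>\<^sub>m (x - 1\<^sub>m n) \<in> lowering n S (Suc k)"
proof -
  let ?X = "x - 1\<^sub>m n"
  have X: "?X \<in> carrier_mat n n" using x(2) by (rule lowering_carrier)
  have "binomial_power n x t - 1\<^sub>m n
      = mat_lincomb n {1..Suc n} (\<lambda>k. t gchoose k) (\<lambda>k. ?X ^\<^sub>m k)"
  proof (rule eq_matI)
    fix i j
    assume "i < dim_row (mat_lincomb n {1..Suc n} (\<lambda>k. t gchoose k) (\<lambda>k. ?X ^\<^sub>m k))"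
      "j < dim_col (mat_lincomb n {1..Suc n} (\<lambda>k. t gchoose k) (\<lambda>k. ?X ^\<^sub>m k))"
    then have ij: "i < n" "j < n" by simp_all
    have "{..Suc n} = insert 0 {1..Suc n}" by auto
    then show "(binomial_power n x t - 1\<^sub>m n) $$ (i, j)
        = mat_lincomb n {1..Suc n} (\<lambda>k. t gchoose k) (\<lambda>k. ?X ^\<^sub>m k) $$ (i, j)"
      using ij X by (simp add: binomial_power_def del: sum.atMost_Suc sum.cl_ivl_Suc pow_mat.simps(2))
  qed (simp_all add: binomial_power_def)
  moreover have "mat_lincomb n {1..Suc n} (\<lambda>k. t gchoose k) (\<lambda>k. ?X ^\<^sub>m k)
      = t \<cdot>\<^sub>m ?X + mat_lincomb n {2..Suc n} (\<lambda>k. t gchoose k) (\<lambda>k. ?X ^\<^sub>m k)"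
  proof -
    have "{1..Suc n} = insert 1 {2..Suc n}" by auto
    then show ?thesis
      using mat_lincomb_insert[of "{2..Suc n}" 1 "\<lambda>k. ?X ^\<^sub>m k" n "\<lambda>k. t gchoose k"] X by simp
  qed
  moreover have rest: "mat_lincomb n {2..Suc n} (\<lambda>k. t gchoose k) (\<lambda>k. ?X ^\<^sub>m k) \<in> lowering n S (Suc k)"
  proof (rule lowering_mat_lincomb)
    fix j assume "j \<in> {2..Suc n}"
    then obtain m where "j = Suc (Suc m)" by (metis atLeastAtMost_iff le_Suc_ex numeral_2_eq_2 add_Suc)
    then show "?X ^\<^sub>m j \<in> lowering n S (Suc k)" using lowering_pow(2)[OF x(2) k] by simp
  qed simp
  ultimately have eq: "binomial_power n x t - 1\<^sub>m n
      = t \<cdot>\<^sub>m ?X + mat_lincomb n {2..Suc n} (\<lambda>k. t gchoose k) (\<lambda>k. ?X ^\<^sub>m k)" by simp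
  show "binomial_power n x t - 1\<^sub>m n \<in> lowering n S k"
    unfolding eq using rest x(2) by (intro lowering_add lowering_smult) (auto intro: lowering_antimono)
  have "binomial_power n x t - 1\<^sub>m n - t \<cdot>\<^sub>m ?X
      = mat_lincomb n {2..Suc n} (\<lambda>k. t gchoose k) (\<lambda>k. ?X ^\<^sub>m k)"
    unfolding eq using X by (intro eq_matI) auto
  then show "binomial_power n x t - 1\<^sub>m n - t \<cdot>\<^sub>m ?X \<in> lowering n S (Suc k)" using rest by simp
qed

text \<open>To first order products become sums: the correction \<open>(x - 1) (y - 1)\<close> lies deeper.\<close>

lemma lowering_prod:
  assumes x: "x \<in> carrier_mat n n" "x - 1\<^sub>m n \<in> lowering n S k"
    and y: "y \<in> carrier_mat n n" "y - 1\<^sub>m n \<in> lowering n S k" and k: "1 \<le> k"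
    and A: "x - 1\<^sub>m n - A \<in> lowering n S (Suc k)" "A \<in> carrier_mat n n"
    and B: "y - 1\<^sub>m n - B \<in> lowering n S (Suc k)" "B \<in> carrier_mat n n"
  shows "x * y - 1\<^sub>m n - (A + B) \<in> lowering n S (Suc k)"
proof -
  have "(x - 1\<^sub>m n) * (y - 1\<^sub>m n) \<in> lowering n S (Suc k)"
    using lowering_mult[OF x(2) y(2)] by (rule lowering_antimono) (use k in simp)
  then have "(x - 1\<^sub>m n) * (y - 1\<^sub>m n) + ((x - 1\<^sub>m n - A) + (y - 1\<^sub>m n - B)) \<in> lowering n S (Suc k)"
    using A B by (intro lowering_add)
  moreover have "(x - 1\<^sub>m n) * (y - 1\<^sub>m n) + ((x - 1\<^sub>m n - A) + (y - 1\<^sub>m n - B))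
      = x * y - 1\<^sub>m n - (A + B)"
    unfolding sub_one_mult[OF x(1) y(1)] using x y A B by (intro eq_matI) auto
  ultimately show ?thesis by simp
qed

context
  assumes flag: "fixed_flag n S n = carrier_vec n"
begin

lemma lowering_top:
  assumes "X \<in> lowering n S k" "n \<le> k" shows "X = 0\<^sub>m n n"
proof (rule mat_eq_zero_of_vec)
  have X: "X \<in> lowering n S n" using assms by (rule lowering_antimono)
  then show "X \<in> carrier_mat n n" by (rule lowering_carrier)
  show "X *\<^sub>v v = 0\<^sub>v n" if "v \<in> carrier_vec n" for v
  proof -
    have "v \<in> fixed_flag n S (0 + n)" using that flag by simp
    then have "X *\<^sub>v v \<in> fixed_flag n S 0" using X unfolding lowering_def by blast
    then show ?thesis by simp
  qed
qed

lemma lowering_pow_zero: "X \<in> lowering n S 1 \<Longrightarrow> n \<le> k \<Longrightarrow> X ^\<^sub>m k = 0\<^sub>m n n"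
proof -
  assume X: "X \<in> lowering n S 1" and k: "n \<le> k"
  have "X ^\<^sub>m k \<in> lowering n S k" for k
  proof (induction k)
    case 0
    show ?case using lowering_one lowering_carrier[OF X] by simp
  next
    case (Suc k)
    then show ?case using lowering_mult[OF Suc X] by simp
  qed
  then show ?thesis using k lowering_top by blast
qed

context
  fixes x assumes x: "x \<in> carrier_mat n n" "x - 1\<^sub>m n \<in> lowering n S 1"
begin

lemma binomial_power_zero: "binomial_power n x 0 = 1\<^sub>m n"
proof (rule eq_matI)
  fix i j assume "i < dim_row (1\<^sub>m n :: 'l mat)" "j < dim_col (1\<^sub>m n :: 'l mat)"
  then have ij: "i < n" "j < n" by simp_all
  have "(\<Sum>k\<le>Suc n. (0 gchoose k) * ((x - 1\<^sub>m n) ^\<^sub>m k) $$ (i, j))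
      = (\<Sum>k\<in>{0}. (0 gchoose k) * ((x - 1\<^sub>m n) ^\<^sub>m k) $$ (i, j))"
    by (rule sum.mono_neutral_right) (auto simp: gbinomial_0_left)
  then show "binomial_power n x 0 $$ (i, j) = 1\<^sub>m n $$ (i, j)"
    unfolding binomial_power_def mat_lincomb_index[OF ij] using ij x by simp
qed (auto simp: binomial_power_def)

text \<open>Pascal's rule for generalized binomial coefficients.\<close>

lemma binomial_power_add_one: "binomial_power n x (t + 1) = binomial_power n x t * x"
proof -
  let ?X = "x - 1\<^sub>m n"
  have X: "?X \<in> carrier_mat n n" using x(2) by (rule lowering_carrier)
  have "binomial_power n x t * x = binomial_power n x t * (?X + 1\<^sub>m n)"
  proof -
    have "?X + 1\<^sub>m n = x" using x(1) by (intro eq_matI) auto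
    then show ?thesis by simp
  qed
  also have "\<dots> = binomial_power n x t * ?X + binomial_power n x t"
    using X by (simp add: mult_add_distrib_mat[of _ n n _ n]
        right_mult_one_mat[OF binomial_power_carrier])
  also have "binomial_power n x t * ?X
      = mat_lincomb n {..Suc n} (\<lambda>k. t gchoose k) (\<lambda>k. ?X ^\<^sub>m Suc k)"
    unfolding binomial_power_def using X by (simp add: mat_lincomb_mult_right)
  also have "\<dots> + binomial_power n x t = binomial_power n x (t + 1)"
  proof (rule eq_matI)
    fix i j assume "i < dim_row (binomial_power n x (t + 1))" "j < dim_col (binomial_power n x (t + 1))"
    then have ij: "i < n" "j < n" by (simp_all add: binomial_power_def)
    define e where "e k = (?X ^\<^sub>m k) $$ (i, j)" for k
    have "?X ^\<^sub>m Suc (Suc n) = 0\<^sub>m n n" by (rule lowering_pow_zero[OF x(2)]) simp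
    then have e_top: "e (Suc (Suc n)) = 0" unfolding e_def using ij by simp
    have "(\<Sum>k\<le>Suc n. (t + 1 gchoose k) * e k) = e 0 + (\<Sum>k\<le>n. (t + 1 gchoose Suc k) * e (Suc k))"
      by (subst sum.atMost_Suc_shift) simp
    also have "\<dots> = (\<Sum>k\<le>n. (t gchoose k) * e (Suc k))
        + (e 0 + (\<Sum>k\<le>n. (t gchoose Suc k) * e (Suc k)))"
      by (simp add: gbinomial_Suc_Suc distrib_right sum.distrib)
    also have "e 0 + (\<Sum>k\<le>n. (t gchoose Suc k) * e (Suc k)) = (\<Sum>k\<le>Suc n. (t gchoose k) * e k)"
      by (subst sum.atMost_Suc_shift) simp
    also have "(\<Sum>k\<le>n. (t gchoose k) * e (Suc k)) = (\<Sum>k\<le>Suc n. (t gchoose k) * e (Suc k))"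
      using e_top by simp
    finally have "(\<Sum>k\<le>Suc n. (t gchoose k) * e (Suc k)) + (\<Sum>k\<le>Suc n. (t gchoose k) * e k)
        = (\<Sum>k\<le>Suc n. (t + 1 gchoose k) * e k)" by (rule sym)
    moreover have "binomial_power n x s $$ (i, j) = (\<Sum>k\<le>Suc n. (s gchoose k) * e k)" for s
      unfolding binomial_power_def mat_lincomb_index[OF ij] e_def ..
    moreover have "mat_lincomb n {..Suc n} (\<lambda>k. t gchoose k) (\<lambda>k. ?X ^\<^sub>m Suc k) $$ (i, j)
        = (\<Sum>k\<le>Suc n. (t gchoose k) * e (Suc k))"
      unfolding mat_lincomb_index[OF ij] e_def ..
    moreover have "dim_row (binomial_power n x t) = n" "dim_col (binomial_power n x t) = n"
      by (simp_all add: binomial_power_def)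
    ultimately show "(mat_lincomb n {..Suc n} (\<lambda>k. t gchoose k) (\<lambda>k. ?X ^\<^sub>m Suc k)
        + binomial_power n x t) $$ (i, j) = binomial_power n x (t + 1) $$ (i, j)"
      using ij by (simp only: index_add_mat(1))
  qed (simp_all add: binomial_power_def)
  finally show ?thesis by simp
qed

lemma binomial_power_one: "binomial_power n x 1 = x"
  using binomial_power_add_one[of 0] x by (simp add: binomial_power_zero)

text \<open>For natural \<open>t\<close> the law is the iterated case of adding 1; both sides are polynomial in \<open>t\<close>. This
avoids Vandermonde's identity.\<close>

lemma binomial_power_add: "binomial_power n x (s + t) = binomial_power n x s * binomial_power n x t"
proof (rule polynomial_matrix_unique[of n "\<lambda>t. binomial_power n x (s + t)"
      "\<lambda>t. binomial_power n x s * binomial_power n x t"])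
  have const: "polynomial_matrix n (\<lambda>t. x)" using x by (simp add: polynomial_matrix_const)
  show "polynomial_matrix n (\<lambda>t. binomial_power n x (s + t))"
    by (intro polynomial_matrix_binomial_power const polynomial_in_add polynomial_in_const polynomial_in_id)
  show "polynomial_matrix n (\<lambda>t. binomial_power n x s * binomial_power n x t)"
    by (intro polynomial_matrix_mult polynomial_matrix_binomial_power[OF const]
        polynomial_matrix_const polynomial_in_id) simp
  show "binomial_power n x (s + of_nat m) = binomial_power n x s * binomial_power n x (of_nat m)" for m
  proof (induction m)
    case (Suc m)
    have "binomial_power n x (s + of_nat (Suc m)) = binomial_power n x (s + of_nat m + 1)"
      by (simp add: algebra_simps)
    also have "\<dots> = binomial_power n x s * binomial_power n x (of_nat m) * x"
      unfolding binomial_power_add_one Suc ..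
    also have "\<dots> = binomial_power n x s * (binomial_power n x (of_nat m) * x)"
      using x by (intro assoc_mult_mat[of _ n n _ n _ n]) auto
    also have "binomial_power n x (of_nat m) * x = binomial_power n x (of_nat (Suc m))"
      unfolding binomial_power_add_one[symmetric] by (simp add: algebra_simps)
    finally show ?case .
  qed (simp add: binomial_power_zero right_mult_one_mat[of _ n n])
qed

end

lemma binomial_power_power:
  assumes x: "x \<in> carrier_mat n n" "x - 1\<^sub>m n \<in> lowering n S 1"
  shows "binomial_power n (binomial_power n x s) t = binomial_power n x (s * t)"
proof (rule polynomial_matrix_unique[of n "\<lambda>t. binomial_power n (binomial_power n x s) t"
      "\<lambda>t. binomial_power n x (s * t)"])
  have const: "polynomial_matrix n (\<lambda>t. x)" "polynomial_matrix n (\<lambda>t. binomial_power n x s)"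
    using x by (simp_all add: polynomial_matrix_const)
  show "polynomial_matrix n (binomial_power n (binomial_power n x s))"
    by (intro polynomial_matrix_binomial_power[OF const(2), of "\<lambda>t. t"] polynomial_in_id)
  show "polynomial_matrix n (\<lambda>t. binomial_power n x (s * t))"
    by (intro polynomial_matrix_binomial_power const polynomial_in_mult polynomial_in_const polynomial_in_id)
  have low: "binomial_power n x s - 1\<^sub>m n \<in> lowering n S 1"
    using x by (intro binomial_power_lowering(1)) simp_all
  show "binomial_power n (binomial_power n x s) (of_nat m) = binomial_power n x (s * of_nat m)" for m
  proof (induction m)
    case 0
    show ?case using x low by (simp add: binomial_power_zero)
  next
    case (Suc m)
    have "binomial_power n (binomial_power n x s) (of_nat (Suc m))
        = binomial_power n (binomial_power n x s) (of_nat m + 1)" by (simp add: add.commute)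
    also have "\<dots> = binomial_power n x (s * of_nat m) * binomial_power n x s"
      unfolding binomial_power_add_one[OF binomial_power_carrier low] Suc ..
    also have "\<dots> = binomial_power n x (s * of_nat (Suc m))"
      unfolding binomial_power_add[OF x, symmetric] by (simp add: algebra_simps)
    finally show ?case .
  qed
qed

end

end

section \<open>Interpolation in unipotent matrix groups\<close>

locale unipotent_matrix_group = group G
  for G :: "'l::field_char_0 mat monoid" (structure) and n :: nat +
  assumes carrier_G: "carrier G \<subseteq> carrier_mat n n"
    and mult_G: "x \<in> carrier G \<Longrightarrow> y \<in> carrier G \<Longrightarrow> x \<otimes> y = x * y"
    and one_G: "\<one> = 1\<^sub>m n"
    and flag: "fixed_flag n (carrier G) n = carrier_vec n"
    and binomial_power_closed: "x \<in> carrier G \<Longrightarrow> binomial_power n x t \<in> carrier G"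
begin

abbreviation level :: "nat \<Rightarrow> 'l mat set" where
  "level \<equiv> lowering n (carrier G)"

lemma mat_carrier: "x \<in> carrier G \<Longrightarrow> x \<in> carrier_mat n n"
  using carrier_G by auto

lemma level_one: "x \<in> carrier G \<Longrightarrow> x - 1\<^sub>m n \<in> level 1"
  using lowering_gen[OF carrier_G] .

lemma level_zero: "x \<in> carrier G \<Longrightarrow> x \<in> level 0"
proof -
  assume x: "x \<in> carrier G"
  have "x - 1\<^sub>m n \<in> level 0" using lowering_antimono[OF carrier_G level_one[OF x]] by simp
  then have "(x - 1\<^sub>m n) + 1\<^sub>m n \<in> level 0"
    using lowering_add[OF carrier_G _ lowering_one[OF carrier_G]] by blast
  moreover have "(x - 1\<^sub>m n) + 1\<^sub>m n = x" using mat_carrier[OF x] by (intro eq_matI) auto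
  ultimately show ?thesis by simp
qed

lemma level_mult_group:
  assumes "X \<in> level k" "g \<in> carrier G"
  shows "X * g \<in> level k" "g * X \<in> level k"
  using lowering_mult[OF carrier_G assms(1) level_zero[OF assms(2)]]
    lowering_mult[OF carrier_G level_zero[OF assms(2)] assms(1)] by simp_all

lemma inv_mult_mat: "x \<in> carrier G \<Longrightarrow> x * inv x = 1\<^sub>m n"
  using mult_G[of x "inv x"] one_G by simp

text \<open>The descending central filtration of the group that is induced by the flag.\<close>

definition congruence_subgroup :: "nat \<Rightarrow> 'l mat set" where
  "congruence_subgroup k = {x \<in> carrier G. x - 1\<^sub>m n \<in> level k}"

lemma quotient_sub_one:
  assumes x: "x \<in> carrier G" and y: "y \<in> carrier G"
  shows "x \<otimes> inv y - 1\<^sub>m n = (x - y) * inv y"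
proof -
  have "(x - y) * inv y = x * inv y - y * inv y"
    using assms by (intro minus_mult_distrib_mat) (auto intro: mat_carrier)
  then show ?thesis using assms by (simp add: mult_G inv_mult_mat)
qed

lemma congruence_subgroup_subgroup: "subgroup (congruence_subgroup k) G"
proof (rule subgroup.intro)
  show "congruence_subgroup k \<subseteq> carrier G" by (auto simp: congruence_subgroup_def)
  have "\<one> - 1\<^sub>m n = 0\<^sub>m n n" unfolding one_G by (rule eq_matI) auto
  then have "\<one> - 1\<^sub>m n \<in> level k" using lowering_zero[OF carrier_G] by (simp only:)
  then show "\<one> \<in> congruence_subgroup k"
    by (simp only: congruence_subgroup_def mem_Collect_eq one_closed simp_thms)
next
  fix x y assume "x \<in> congruence_subgroup k" "y \<in> congruence_subgroup k"
  then have xy: "x \<in> carrier G" "y \<in> carrier G" "x - 1\<^sub>m n \<in> level k" "y - 1\<^sub>m n \<in> level k"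
    by (auto simp: congruence_subgroup_def)
  have "(x - 1\<^sub>m n) * y = x * y - 1\<^sub>m n * y"
    using xy by (intro minus_mult_distrib_mat) (auto intro: mat_carrier)
  then have "x * y - 1\<^sub>m n = (x - 1\<^sub>m n) * y + (y - 1\<^sub>m n)"
    using mat_carrier[OF xy(1)] mat_carrier[OF xy(2)] by (intro eq_matI) auto
  also have "\<dots> \<in> level k"
    using xy by (intro lowering_add[OF carrier_G] level_mult_group)
  finally show "x \<otimes> y \<in> congruence_subgroup k"
    using xy by (simp add: congruence_subgroup_def mult_G[symmetric])
next
  fix x assume "x \<in> congruence_subgroup k"
  then have x: "x \<in> carrier G" "x - 1\<^sub>m n \<in> level k" by (auto simp: congruence_subgroup_def)
  have "inv x - 1\<^sub>m n = (1\<^sub>m n - x) * inv x"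
    using quotient_sub_one[OF one_closed x(1)] x(1) by (simp add: one_G[symmetric])
  also have "1\<^sub>m n - x = (-1) \<cdot>\<^sub>m (x - 1\<^sub>m n)"
    using mat_carrier[OF x(1)] by (intro eq_matI) auto
  also have "(-1) \<cdot>\<^sub>m (x - 1\<^sub>m n) * inv x \<in> level k"
    using x by (intro level_mult_group lowering_smult[OF carrier_G]) auto
  finally show "inv x \<in> congruence_subgroup k" using x by (simp add: congruence_subgroup_def)
qed

text \<open>Here \<open>[x, y] - 1 = (x y - y x) (y x)\<^sup>-\<^sup>1\<close>, and \<open>x y - y x\<close> is also the additive commutator of
\<open>x - 1\<close> and \<open>y - 1\<close>.\<close>

lemma commutator_congruence:
  assumes x: "x \<in> carrier G" "x - 1\<^sub>m n \<in> level k" and y: "y \<in> carrier G"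
  shows "commutator G x y - 1\<^sub>m n \<in> level (Suc k)"
proof -
  have "commutator G x y - 1\<^sub>m n = (x \<otimes> y) \<otimes> inv (y \<otimes> x) - 1\<^sub>m n"
    using x y by (simp add: commutator_def group_cancel)
  also have "\<dots> = (x * y - y * x) * inv (y \<otimes> x)"
    unfolding quotient_sub_one[OF m_closed[OF x(1) y] m_closed[OF y x(1)]]
    by (simp only: mult_G[OF x(1) y] mult_G[OF y x(1)])
  also have "x * y - y * x
      = (x - 1\<^sub>m n) * (y - 1\<^sub>m n) - (y - 1\<^sub>m n) * (x - 1\<^sub>m n)"
    unfolding sub_one_mult[OF mat_carrier[OF x(1)] mat_carrier[OF y]]
      sub_one_mult[OF mat_carrier[OF y] mat_carrier[OF x(1)]]
    using mat_carrier[OF x(1)] mat_carrier[OF y] by (intro eq_matI) auto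
  also have "\<dots> * inv (y \<otimes> x) \<in> level (Suc k)"
  proof -
    have "(x - 1\<^sub>m n) * (y - 1\<^sub>m n) \<in> level (Suc k)"
      using lowering_mult[OF carrier_G x(2) level_one[OF y]] by simp
    moreover have "(y - 1\<^sub>m n) * (x - 1\<^sub>m n) \<in> level (Suc k)"
      using lowering_mult[OF carrier_G level_one[OF y] x(2)] by simp
    ultimately show ?thesis
      using level_mult_group(1)[OF lowering_diff[OF carrier_G]] x(1) y by simp
  qed
  finally show ?thesis .
qed

lemma lower_central_congruence: "lower_central G k \<subseteq> congruence_subgroup (Suc k)"
proof (induction k)
  case 0
  show ?case using level_one by (auto simp: congruence_subgroup_def)
next
  case (Suc k)
  show ?case
    unfolding lower_central.simps
  proof (rule generate_subgroup_incl[OF _ congruence_subgroup_subgroup], clarify)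
    fix x y assume "x \<in> lower_central G k" and y: "y \<in> carrier G"
    then have "x \<in> carrier G" "x - 1\<^sub>m n \<in> level (Suc k)"
      using Suc by (auto simp: congruence_subgroup_def)
    then show "commutator G x y \<in> congruence_subgroup (Suc (Suc k))"
      using commutator_congruence y by (simp add: congruence_subgroup_def)
  qed
qed

lemma congruence_subgroup_trivial:
  assumes "x \<in> congruence_subgroup k" "n \<le> k" shows "x = \<one>"
proof -
  have x: "x \<in> carrier G" and "x - 1\<^sub>m n = 0\<^sub>m n n"
    using assms lowering_top[OF carrier_G flag] by (auto simp: congruence_subgroup_def)
  moreover have "x = (x - 1\<^sub>m n) + 1\<^sub>m n" using mat_carrier[OF x] by (intro eq_matI) auto
  ultimately show ?thesis using one_G by simp
qed

lemma nilpotent: "lower_central G n = {\<one>}"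
  using lower_central_congruence[of n] congruence_subgroup_trivial[of _ "Suc n"]
    subgroup.one_closed[OF lower_central_subgroup[of n]] by auto

definition polynomial_maps :: "('l \<Rightarrow> 'l mat) set" where
  "polynomial_maps = {f. (\<forall>t. f t \<in> carrier G) \<and> polynomial_matrix n f}"

lemma inv_eq_binomial_power: "x \<in> carrier G \<Longrightarrow> inv x = binomial_power n x (-1)"
proof -
  assume x: "x \<in> carrier G"
  note b = mat_carrier[OF x] level_one[OF x]
  have "binomial_power n x (-1) * x = 1\<^sub>m n"
    using binomial_power_add[OF carrier_G flag b, of "-1" 1]
    by (simp add: binomial_power_one[OF carrier_G flag b] binomial_power_zero[OF carrier_G flag b])
  then show ?thesis
    using x binomial_power_closed[OF x, of "-1"] mult_G one_G by (intro inv_equality) auto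
qed

lemma polynomial_maps_mult:
  assumes "f \<in> polynomial_maps" "g \<in> polynomial_maps"
  shows "(\<lambda>t. f t \<otimes> g t) \<in> polynomial_maps"
proof -
  have "(\<lambda>t. f t \<otimes> g t) = (\<lambda>t. f t * g t)"
    using assms by (auto simp: polynomial_maps_def mult_G)
  then have "polynomial_matrix n (\<lambda>t. f t \<otimes> g t)"
    using assms by (simp add: polynomial_maps_def polynomial_matrix_mult)
  then show ?thesis using assms by (simp add: polynomial_maps_def)
qed

lemma polynomial_maps_power:
  assumes "f \<in> polynomial_maps" "polynomial_in id c"
  shows "(\<lambda>t. binomial_power n (f t) (c t)) \<in> polynomial_maps"
  using assms by (simp add: polynomial_maps_def binomial_power_closed polynomial_matrix_binomial_power)

lemma polynomial_maps_const: "x \<in> carrier G \<Longrightarrow> (\<lambda>t. x) \<in> polynomial_maps"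
  by (simp add: polynomial_maps_def polynomial_matrix_const mat_carrier)

lemma polynomial_maps_inv:
  assumes "f \<in> polynomial_maps" shows "(\<lambda>t. inv (f t)) \<in> polynomial_maps"
proof -
  have "(\<lambda>t. inv (f t)) = (\<lambda>t. binomial_power n (f t) (-1))"
    using assms by (auto simp: polynomial_maps_def inv_eq_binomial_power)
  then show ?thesis using polynomial_maps_power[OF assms polynomial_in_const] by simp
qed

lemma polynomial_matrix_interpolation:
  assumes f: "polynomial_matrix n f"
  obtains d :: nat and l :: "nat \<Rightarrow> 'l poly"
  where "\<And>t. f t - 1\<^sub>m n = mat_lincomb n {..<d} (\<lambda>j. poly (l j) t) (\<lambda>j. f (of_nat j) - 1\<^sub>m n)"
proof -
  have "\<forall>i\<in>{..<n}. \<forall>j\<in>{..<n}. \<exists>q. \<forall>t. (f t - 1\<^sub>m n) $$ (i, j) = poly q t"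
    using polynomial_matrix_sub_one[OF f] by (auto simp: polynomial_matrix_def polynomial_in_def)
  then obtain q where q: "\<And>i j t. i < n \<Longrightarrow> j < n \<Longrightarrow> (f t - 1\<^sub>m n) $$ (i, j) = poly (q i j) t"
    by (metis lessThan_iff)
  define d where "d = Suc (\<Sum>i<n. \<Sum>j<n. degree (q i j))"
  have deg: "degree (q i j) < d" if "i < n" "j < n" for i j
  proof -
    have "degree (q i j) \<le> (\<Sum>j<n. degree (q i j))"
      using that by (intro member_le_sum) auto
    also have "\<dots> \<le> (\<Sum>i<n. \<Sum>j<n. degree (q i j))"
      using that by (intro member_le_sum) auto
    finally show ?thesis by (simp add: d_def)
  qed
  obtain l :: "nat \<Rightarrow> 'l poly"
    where l: "\<And>p t. degree p < d \<Longrightarrow> poly p t = (\<Sum>j<d. poly (l j) t * poly p (of_nat j))"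
    using lagrange_interpolation by blast
  have "f t - 1\<^sub>m n = mat_lincomb n {..<d} (\<lambda>j. poly (l j) t) (\<lambda>j. f (of_nat j) - 1\<^sub>m n)" for t
  proof (rule eq_matI)
    fix i j
    assume "i < dim_row (mat_lincomb n {..<d} (\<lambda>j. poly (l j) t) (\<lambda>j. f (of_nat j) - 1\<^sub>m n))"
      "j < dim_col (mat_lincomb n {..<d} (\<lambda>j. poly (l j) t) (\<lambda>j. f (of_nat j) - 1\<^sub>m n))"
    then have ij: "i < n" "j < n" by simp_all
    show "(f t - 1\<^sub>m n) $$ (i, j)
        = mat_lincomb n {..<d} (\<lambda>j. poly (l j) t) (\<lambda>j. f (of_nat j) - 1\<^sub>m n) $$ (i, j)"
      unfolding mat_lincomb_index[OF ij] q[OF ij] by (rule l[OF deg[OF ij]])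
  qed simp_all
  then show ?thesis by (rule that)
qed

text \<open>Descending induction on the level \<open>k\<close> of the congruence subgroup that contains the values of \<open>f\<close>.
Modulo the next level multiplication is addition of the matrices \<open>x - 1\<close>, and powers are scalar
multiples. The Lagrange formula for \<open>f\<close> therefore says that \<open>f(t)\<close> agrees with the product \<open>g(t)\<close> of
the powers of \<open>f(0), f(1), ...\<close> whose exponents are the Lagrange polynomials at \<open>t\<close>. As \<open>K\<close> is closed
under powers, \<open>g(t) \<in> K\<close> for every \<open>t\<close>, and the induction hypothesis applies to \<open>f g\<^sup>-\<^sup>1\<close>.\<close>

lemma interpolation:
  assumes K: "subgroup K G" and power: "\<And>x t. x \<in> K \<Longrightarrow> binomial_power n x t \<in> K"
    and f: "f \<in> polynomial_maps" and nat: "\<And>m. f (of_nat m) \<in> K"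
  shows "f t \<in> K"
proof -
  interpret K: subgroup K G by fact
  have descend: "f t \<in> K"
    if "f \<in> polynomial_maps" "\<And>t. f t \<in> congruence_subgroup k" "\<And>m. f (of_nat m) \<in> K"
      "k = Suc n - i" "i \<le> n" for f k i t
    using that
  proof (induction i arbitrary: f k t)
    case 0
    then have "f t = \<one>" by (intro congruence_subgroup_trivial[of _ k]) auto
    then show ?case by simp
  next
    case (Suc i)
    have k: "1 \<le> k" "Suc k = Suc n - i" using Suc.prems by auto
    have fG: "f t \<in> carrier G" "f t - 1\<^sub>m n \<in> level k" for t
      using Suc.prems(2)[of t] by (auto simp: congruence_subgroup_def)
    obtain d l where l: "\<And>t. f t - 1\<^sub>m n
        = mat_lincomb n {..<d} (\<lambda>j. poly (l j) t) (\<lambda>j. f (of_nat j) - 1\<^sub>m n)"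
      using polynomial_matrix_interpolation[of f] Suc.prems(1) by (auto simp: polynomial_maps_def)
    \<comment> \<open>\<open>L m\<close> and \<open>g m\<close> are the additive and the multiplicative form of the interpolation formula,
      truncated after \<open>m\<close> nodes.\<close>
    define L where "L m t = mat_lincomb n {..<m} (\<lambda>j. poly (l j) t) (\<lambda>j. f (of_nat j) - 1\<^sub>m n)" for m t
    define g where "g m t = rec_nat \<one> (\<lambda>j y. y \<otimes> binomial_power n (f (of_nat j)) (poly (l j) t)) m" for m t
    have g_simps: "g 0 t = \<one>"
      "g (Suc m) t = g m t \<otimes> binomial_power n (f (of_nat m)) (poly (l m) t)" for m t
      by (simp_all add: g_def)
    have g_maps: "g m \<in> polynomial_maps" for m
    proof (induction m)
      case 0
      have "g 0 = (\<lambda>t. \<one>)" by (rule ext) (simp add: g_simps)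
      then show ?case by (simp add: polynomial_maps_const)
    next
      case (Suc m)
      have "g (Suc m) = (\<lambda>t. g m t \<otimes> binomial_power n (f (of_nat m)) (poly (l m) t))"
        by (rule ext) (simp add: g_simps)
      moreover have "polynomial_in id (poly (l m))" by (auto simp: polynomial_in_def)
      ultimately show ?case
        using Suc fG by (auto intro!: polynomial_maps_mult polynomial_maps_power polynomial_maps_const)
    qed
    have gG: "g m t \<in> carrier G" for m t using g_maps by (simp add: polynomial_maps_def)
    have gK: "g m t \<in> K" for m t
      by (induction m) (auto simp: g_simps Suc.prems(3) power)
    have approx: "g m t - 1\<^sub>m n \<in> level k \<and> g m t - 1\<^sub>m n - L m t \<in> level (Suc k)" for m t
    proof (induction m)
      case 0
      have "g 0 t - 1\<^sub>m n = 0\<^sub>m n n" "g 0 t - 1\<^sub>m n - L 0 t = 0\<^sub>m n n"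
        unfolding g_simps one_G L_def by (intro eq_matI; simp)+
      then show ?case using lowering_zero[OF carrier_G] by simp
    next
      case (Suc m)
      let ?x = "f (of_nat m)" and ?s = "poly (l m) t"
      let ?b = "binomial_power n ?x ?s"
      have b: "?b \<in> carrier G" "?b - 1\<^sub>m n \<in> level k"
        "?b - 1\<^sub>m n - ?s \<cdot>\<^sub>m (?x - 1\<^sub>m n) \<in> level (Suc k)"
        using binomial_power_closed[OF fG(1)]
          binomial_power_lowering[OF carrier_G mat_carrier[OF fG(1)] fG(2) k(1)] by auto
      have "g m t \<in> congruence_subgroup k" "?b \<in> congruence_subgroup k"
        using Suc gG b by (auto simp: congruence_subgroup_def)
      then have "g m t \<otimes> ?b \<in> congruence_subgroup k"
        using subgroup.m_closed[OF congruence_subgroup_subgroup] by blast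
      then have "g (Suc m) t - 1\<^sub>m n \<in> level k" by (simp add: g_simps congruence_subgroup_def)
      moreover have "L (Suc m) t = ?s \<cdot>\<^sub>m (?x - 1\<^sub>m n) + L m t"
        unfolding L_def lessThan_Suc
        using fG lowering_carrier[OF carrier_G] by (intro mat_lincomb_insert) auto
      moreover have "\<dots> = L m t + ?s \<cdot>\<^sub>m (?x - 1\<^sub>m n)"
        unfolding L_def using mat_carrier[OF fG(1)] by (intro eq_matI) auto
      moreover have "g m t * ?b - 1\<^sub>m n - (L m t + ?s \<cdot>\<^sub>m (?x - 1\<^sub>m n)) \<in> level (Suc k)"
        using Suc b gG k(1) fG
        by (intro lowering_prod[OF carrier_G])
          (auto simp: L_def intro: mat_carrier minus_carrier_mat)
      ultimately show ?case using gG b by (simp add: g_simps mult_G)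
    qed
    define h where "h t = f t \<otimes> inv (g d t)" for t
    have h_maps: "h \<in> polynomial_maps"
      unfolding h_def using Suc.prems(1) g_maps by (intro polynomial_maps_mult polynomial_maps_inv)
    have "h t \<in> congruence_subgroup (Suc k)" for t
    proof -
      have "f t - 1\<^sub>m n = L d t" unfolding L_def by (rule l)
      have "f t - g d t = (-1) \<cdot>\<^sub>m (g d t - 1\<^sub>m n - (f t - 1\<^sub>m n))"
        using mat_carrier[OF fG(1)[of t]] mat_carrier[OF gG[of d t]] by (intro eq_matI) auto
      also have "\<dots> \<in> level (Suc k)"
        unfolding \<open>f t - 1\<^sub>m n = L d t\<close> using approx by (intro lowering_smult[OF carrier_G]) auto
      finally have "(f t - g d t) * inv (g d t) \<in> level (Suc k)"
        using gG by (intro level_mult_group) auto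
      then show ?thesis
        using quotient_sub_one[OF fG(1) gG] fG gG by (simp add: congruence_subgroup_def h_def)
    qed
    moreover have "h (of_nat m) \<in> K" for m unfolding h_def using Suc.prems(3) gK by auto
    ultimately have "h t \<in> K" using Suc.IH[OF h_maps _ _ k(2)] Suc.prems(5) by auto
    then have "h t \<otimes> g d t \<in> K" using gK by auto
    then show ?case using fG gG by (simp add: h_def m_assoc)
  qed
  have "f t \<in> congruence_subgroup 1" for t
    using f level_one by (auto simp: polynomial_maps_def congruence_subgroup_def)
  then show ?thesis using descend[of f 1 n t] f nat by simp
qed

sublocale powered_group G "binomial_power n" polynomial_maps
proof unfold_locales
  show "f \<in> polynomial_maps \<Longrightarrow> f t \<in> carrier G" for f t by (simp add: polynomial_maps_def)
  show "binomial_power n x \<in> polynomial_maps" if "x \<in> carrier G" for x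
    using polynomial_maps_power[OF polynomial_maps_const[OF that] polynomial_in_id] .
  show "binomial_power n x (s + t) = binomial_power n x s \<otimes> binomial_power n x t"
    if "x \<in> carrier G" for x s t
    using binomial_power_add[OF carrier_G flag mat_carrier level_one] that
    by (simp add: mult_G binomial_power_closed)
  show "binomial_power n x 1 = x" if "x \<in> carrier G" for x
    using binomial_power_one[OF carrier_G flag mat_carrier level_one] that by simp
  show "binomial_power n (binomial_power n x s) t = binomial_power n x (s * t)"
    if "x \<in> carrier G" for x s t
    using binomial_power_power[OF carrier_G flag mat_carrier level_one] that by simp
qed (fact polynomial_maps_const polynomial_maps_mult polynomial_maps_inv interpolation)+

end

section \<open>Rational points\<close>

lemma GL_simps:
  "mult (GL n) = (*)" "one (GL n) = 1\<^sub>m n"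
  by (simp_all add: GL_def units_of_def ring_mat_def)

lemma carrier_GL_iff:
  "A \<in> carrier (GL n) \<longleftrightarrow> A \<in> carrier_mat n n \<and> (\<exists>B\<in>carrier_mat n n. B * A = 1\<^sub>m n \<and> A * B = 1\<^sub>m n)"
  by (simp add: GL_def units_of_def ring_mat_def Units_def)

lemma group_GL: "group (GL n :: 'a::field mat monoid)"
proof -
  interpret ring "ring_mat TYPE('a) n ()" by (rule ring_mat)
  show ?thesis unfolding GL_def by (rule units_group)
qed

context
  fixes \<iota> :: "'l::field_char_0 \<Rightarrow> 'k::field"
  assumes \<iota>: "field_hom \<iota>"
begin

interpretation field_hom \<iota> by (fact \<iota>)

lemma map_mat_GL:
  assumes "A \<in> carrier (GL n)" shows "map_mat \<iota> A \<in> carrier (GL n)"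
proof -
  obtain B where AB: "A \<in> carrier_mat n n" "B \<in> carrier_mat n n" "B * A = 1\<^sub>m n" "A * B = 1\<^sub>m n"
    using assms by (auto simp: carrier_GL_iff)
  then have "map_mat \<iota> B * map_mat \<iota> A = 1\<^sub>m n" "map_mat \<iota> A * map_mat \<iota> B = 1\<^sub>m n"
    using mat_hom_mult[of B n n A n] mat_hom_mult[of A n n B n] by (simp_all add: mat_hom_one)
  then show ?thesis using AB unfolding carrier_GL_iff by (metis map_carrier_mat)
qed

lemma rational_points_subgroup:
  assumes U: "subgroup U (GL n)"
  shows "subgroup {A \<in> carrier (GL n). map_mat \<iota> A \<in> U} (GL n)"
proof -
  interpret L: group "GL n :: 'l mat monoid" by (rule group_GL)
  interpret K: group "GL n :: 'k mat monoid" by (rule group_GL)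
  interpret U: subgroup U "GL n" by (fact U)
  have mult: "map_mat \<iota> (A * B) = map_mat \<iota> A * map_mat \<iota> B"
    if "A \<in> carrier (GL n)" "B \<in> carrier (GL n)" for A B
    using that by (intro mat_hom_mult) (auto simp: carrier_GL_iff)
  show ?thesis
  proof (rule subgroup.intro)
    fix A B
    assume "A \<in> {A \<in> carrier (GL n). map_mat \<iota> A \<in> U}" "B \<in> {A \<in> carrier (GL n). map_mat \<iota> A \<in> U}"
    then show "A \<otimes>\<^bsub>GL n\<^esub> B \<in> {A \<in> carrier (GL n). map_mat \<iota> A \<in> U}"
      using L.m_closed[of A B] U.m_closed[of "map_mat \<iota> A" "map_mat \<iota> B"] by (simp add: GL_simps mult)
  next
    show "\<one>\<^bsub>GL n\<^esub> \<in> {A \<in> carrier (GL n). map_mat \<iota> A \<in> U}"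
      using U.one_closed L.one_closed by (simp add: GL_simps mat_hom_one)
  next
    fix A assume "A \<in> {A \<in> carrier (GL n). map_mat \<iota> A \<in> U}"
    then have A: "A \<in> carrier (GL n)" "map_mat \<iota> A \<in> U" by auto
    have "inv\<^bsub>GL n\<^esub> (map_mat \<iota> A) = map_mat \<iota> (inv\<^bsub>GL n\<^esub> A)"
    proof (rule K.inv_equality)
      show "map_mat \<iota> (inv\<^bsub>GL n\<^esub> A) \<otimes>\<^bsub>GL n\<^esub> map_mat \<iota> A = \<one>\<^bsub>GL n\<^esub>"
        using mult[OF L.inv_closed[OF A(1)] A(1)] L.l_inv[OF A(1)] by (simp add: GL_simps mat_hom_one)
    qed (use A map_mat_GL in auto)
    then show "inv\<^bsub>GL n\<^esub> A \<in> {A \<in> carrier (GL n). map_mat \<iota> A \<in> U}"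
      using U.m_inv_closed[OF A(2)] A(1) by simp
  qed auto
qed

lemma polynomial_in_hom:
  assumes "polynomial_in id F" shows "polynomial_in \<iota> (\<lambda>t. \<iota> (F t))"
proof -
  obtain q where "\<And>t. F t = poly q t" using assms by (auto simp: polynomial_in_def)
  then have "\<iota> (F t) = poly (map_poly \<iota> q) (\<iota> t)" for t by simp
  then show ?thesis unfolding polynomial_in_def by blast
qed

text \<open>The variables of \<open>p\<close> have indices below \<open>n\<close>, so evaluating \<open>p\<close> reads only genuine entries of the matrix.\<close>

lemma polynomial_in_eval_at:
  assumes f: "polynomial_matrix n f" and p: "p \<in> matrix_polys n"
  shows "polynomial_in \<iota> (\<lambda>t. eval_at (map_mat \<iota> (f t)) p)"
  unfolding eval_at_def
proof (intro polynomial_in_sum polynomial_in_mult polynomial_in_const polynomial_in_prod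
    polynomial_in_power)
  fix m v assume m: "m \<in> Poly_Mapping.keys p" and v: "v \<in> Poly_Mapping.keys m"
  obtain i j where ij: "v = (i, j)" by (cases v)
  have "i < n" "j < n" using p m v unfolding matrix_polys_def ij by blast+
  moreover from this have "map_mat \<iota> (f t) $$ v = \<iota> (f t $$ (i, j))" for t
    using polynomial_matrix_carrier[OF f, of t] ij by simp
  ultimately show "polynomial_in \<iota> (\<lambda>t. map_mat \<iota> (f t) $$ v)"
    using f by (simp add: polynomial_matrix_def polynomial_in_hom)
qed

text \<open>The flag over the small field contains the vectors whose images lie in the flag over the large field.
Thus Kolchin's theorem needs a proof over the algebraically closed field only.\<close>

lemma fixed_flag_descend:
  assumes S: "S \<subseteq> carrier_mat n n" and ST: "\<And>g. g \<in> S \<Longrightarrow> map_mat \<iota> g \<in> T"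
    and v: "v \<in> carrier_vec n" "map_vec \<iota> v \<in> fixed_flag n T m"
  shows "v \<in> fixed_flag n S m"
  using v
proof (induction m arbitrary: v)
  case 0
  then show ?case by simp
next
  case (Suc m)
  have "(g - 1\<^sub>m n) *\<^sub>v v \<in> fixed_flag n S m" if g: "g \<in> S" for g
  proof (rule Suc.IH)
    have gc: "g \<in> carrier_mat n n" using g S by auto
    show "(g - 1\<^sub>m n) *\<^sub>v v \<in> carrier_vec n"
      using mult_mat_vec_carrier[OF minus_carrier_mat[OF one_carrier_mat] Suc.prems(1)] .
    have "map_mat \<iota> (g - 1\<^sub>m n) = map_mat \<iota> g - 1\<^sub>m n"
      using gc by (intro eq_matI) (auto simp: hom_minus)
    then have "map_vec \<iota> ((g - 1\<^sub>m n) *\<^sub>v v) = (map_mat \<iota> g - 1\<^sub>m n) *\<^sub>v map_vec \<iota> v"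
      using mult_mat_vec_hom[of "g - 1\<^sub>m n" n n v] Suc.prems(1) by (simp add: minus_carrier_mat)
    then show "map_vec \<iota> ((g - 1\<^sub>m n) *\<^sub>v v) \<in> fixed_flag n T m"
      using Suc.prems(2) ST[OF g] by simp
  qed
  then show ?case using Suc.prems(1) by simp
qed

end

text \<open>The rational points are closed under binomial powers because an equation of \<open>U\<close>, evaluated along
\<open>t \<mapsto> x\<^sup>t\<close>, is a polynomial in the image of \<open>t\<close> that vanishes at all natural numbers.\<close>

lemma rational_points_unipotent_matrix_group:
  fixes \<iota> :: "'l::field_char_0 \<Rightarrow> 'k::alg_closed_field"
  assumes \<iota>: "field_hom \<iota>" and U: "unipotent_algebraic_group n U"
  shows "unipotent_matrix_group (rational_points \<iota> n U) n"
proof -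
  interpret field_hom \<iota> by (fact \<iota>)
  let ?R = "rational_points \<iota> n U"
  have U_sub: "subgroup U (GL n)" and "zariski_closed_in_GL n U"
    and unipotent: "\<And>A. A \<in> U \<Longrightarrow> unipotent_matrix n A"
    using U by (auto simp: unipotent_algebraic_group_def linear_algebraic_group_def)
  then obtain E where E: "E \<subseteq> matrix_polys n" "U = {A \<in> carrier (GL n). \<forall>p\<in>E. eval_at A p = 0}"
    by (auto simp: zariski_closed_in_GL_def)
  interpret R: group ?R
    unfolding rational_points_def
    using rational_points_subgroup[OF \<iota> U_sub] group_GL by (rule subgroup.subgroup_is_group)
  have R_iff: "A \<in> carrier ?R \<longleftrightarrow> A \<in> carrier (GL n) \<and> map_mat \<iota> A \<in> U" for A
    by (simp add: rational_points_def)
  have carrier: "carrier ?R \<subseteq> carrier_mat n n" by (auto simp: R_iff carrier_GL_iff)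
  have R_simps: "mult ?R = (*)" "one ?R = 1\<^sub>m n"
    by (simp_all add: rational_points_def GL_simps)
  \<comment> \<open>The larger field inherits characteristic 0 through the embedding.\<close>
  have char_0: "of_nat m \<noteq> (0 :: 'k)" if "m > 0" for m
  proof -
    have "(of_nat m :: 'l) \<noteq> 0" using that by simp
    then show ?thesis using hom_0_iff hom_of_nat by metis
  qed
  have "fixed_flag n U n = carrier_vec n"
  proof (rule kolchin[OF char_0 _ unipotent])
    show "g * h \<in> U" if "g \<in> U" "h \<in> U" for g h
      using subgroup.m_closed[OF U_sub that] by (simp add: GL_simps)
  qed
  then have "v \<in> fixed_flag n (carrier ?R) n" if "v \<in> carrier_vec n" for v
    using that by (intro fixed_flag_descend[OF \<iota> carrier, of U]) (auto simp: R_iff)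
  then have flag: "fixed_flag n (carrier ?R) n = carrier_vec n"
    using fixed_flag_carrier by blast
  have "binomial_power n x t \<in> carrier ?R" if x: "x \<in> carrier ?R" for x t
  proof -
    have xc: "x \<in> carrier_mat n n" using x carrier by auto
    note x' = xc lowering_gen[OF carrier x]
    have inverse: "binomial_power n x s * binomial_power n x (- s) = 1\<^sub>m n" for s
      using binomial_power_add[OF carrier flag x', of s "- s"] binomial_power_zero[OF carrier flag x']
      by simp
    have GL: "binomial_power n x s \<in> carrier (GL n)" for s
      using inverse[of s] inverse[of "- s"] unfolding carrier_GL_iff
      by (metis binomial_power_carrier minus_minus)
    have nat: "binomial_power n x (of_nat m) \<in> carrier ?R" for m
    proof (induction m)
      case 0
      show ?case using R.one_closed binomial_power_zero[OF carrier flag x'] by (simp add: R_simps)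
    next
      case (Suc m)
      have "binomial_power n x (of_nat (Suc m)) = binomial_power n x (of_nat m) \<otimes>\<^bsub>?R\<^esub> x"
        using binomial_power_add_one[OF carrier flag x', of "of_nat m"] by (simp add: R_simps add.commute)
      then show ?case using Suc x by simp
    qed
    have "eval_at (map_mat \<iota> (binomial_power n x t)) p = 0" if p: "p \<in> E" for p
    proof (rule polynomial_in_eq_zero[OF \<iota>, where F = "\<lambda>t. eval_at (map_mat \<iota> (binomial_power n x t)) p"])
      show "polynomial_in \<iota> (\<lambda>t. eval_at (map_mat \<iota> (binomial_power n x t)) p)"
        using polynomial_matrix_binomial_power[OF polynomial_matrix_const[OF xc] polynomial_in_id] p E(1)
        by (intro polynomial_in_eval_at[OF \<iota>]) auto
      show "eval_at (map_mat \<iota> (binomial_power n x (of_nat m))) p = 0" for m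
      proof -
        have "map_mat \<iota> (binomial_power n x (of_nat m)) \<in> U" using nat[of m] by (simp add: R_iff)
        then show ?thesis using p E(2) by blast
      qed
    qed
    then have "map_mat \<iota> (binomial_power n x t) \<in> U" using map_mat_GL[OF \<iota> GL] E(2) by blast
    then show ?thesis using GL by (simp add: R_iff)
  qed
  then show ?thesis
    using carrier flag R_simps by unfold_locales auto
qed

theorem theorem1p3:
  fixes H :: "('h, 'm) monoid_scheme"
    and \<iota> :: "'l::field_char_0 \<Rightarrow> 'k::alg_closed_field"
    and n :: nat
    and U :: "'k mat set"
    and \<phi> :: "'l mat \<Rightarrow> 'h"
  assumes "group H"
    and "carrier H \<prec> (UNIV :: 'l set)"
    and "field_hom \<iota>"
    and "unipotent_algebraic_group n U"
    and "defined_over \<iota> n U"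
    and "\<phi> \<in> hom (rational_points \<iota> n U) H"
  shows "comm_group (H\<lparr>carrier := \<phi> ` carrier (rational_points \<iota> n U)\<rparr>)"
proof -
  let ?R = "rational_points \<iota> n U"
  interpret R: unipotent_matrix_group ?R n
    using assms(3,4) by (rule rational_points_unipotent_matrix_group)
  interpret \<phi>: group_hom ?R H \<phi>
    using assms(1,6) by (intro group_hom.intro group_hom_axioms.intro R.is_group)
  have collapse: "\<exists>s. s \<noteq> 0 \<and> \<phi> (binomial_power n u s) = \<one>\<^bsub>H\<^esub>" if u: "u \<in> carrier ?R" for u
  proof -
    \<comment> \<open>This is where the cardinality assumption enters.\<close>
    have "\<not> inj (\<lambda>t. \<phi> (binomial_power n u t))"
    proof
      assume inj: "inj (\<lambda>t. \<phi> (binomial_power n u t))"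
      have "range (\<lambda>t. \<phi> (binomial_power n u t)) \<subseteq> carrier H" using u by auto
      then have "(UNIV :: 'l set) \<lesssim> carrier H" using inj unfolding lepoll_def by blast
      then show False using assms(2) by (meson lepoll_antisym lesspoll_def)
    qed
    then obtain a b where ab: "a \<noteq> b" "\<phi> (binomial_power n u a) = \<phi> (binomial_power n u b)"
      by (auto simp: inj_def)
    have "binomial_power n u a = binomial_power n u (a - b) \<otimes>\<^bsub>?R\<^esub> binomial_power n u b"
      using R.pw_add[OF u, of "a - b" b] by simp
    then have "\<phi> (binomial_power n u (a - b)) \<otimes>\<^bsub>H\<^esub> \<phi> (binomial_power n u b) = \<phi> (binomial_power n u b)"
      using ab(2) u by (metis R.pw_closed \<phi>.hom_mult)
    then have "\<phi> (binomial_power n u (a - b)) = \<one>\<^bsub>H\<^esub>" using u by simp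
    then show ?thesis using ab(1) by (intro exI[of _ "a - b"]) simp
  qed
  have "group (H\<lparr>carrier := \<phi> ` carrier ?R\<rparr>)"
    using \<phi>.img_is_subgroup assms(1) by (rule subgroup.subgroup_is_group)
  then show ?thesis
    using R.image_abelian[OF assms(1,6) R.nilpotent collapse]
    by (intro group.group_comm_groupI) auto
qed

end
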